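(* Let $E=\{a,b,c,d,e,f,g,h,i\}$ and let $M$ be the matroid of rank $3$ on $E$ whose bases are exactly the $3$-element subsets $B\subseteq E$ satisfying $|B\cap F|\le 2$ for every $$F\in\{\{b,d,f,h\},\{a,b,c\},\{a,d,e\},\{a,f,g\},\{a,h,i\},\{b,g,i\},\{c,d,i\},\{c,e,f\},\{e,g,h\}\}.$$ Then the base polytope of $M$ is not decomposable.
   Context: For a matroid $N$ on $E$ with base family $\mathcal{B}(N)$, its base polytope is $B(N)=\mathrm{conv}\{\chi_B : B\in\mathcal{B}(N)\}\subseteq\mathbb{R}^E$, where $\chi_B$ is the incidence vector of $B$; its dimension equals $|E|$ minus the number of connected components of $N$. The base polytope $B(N)$ is called decomposable if there exist at least two matroids $N_1,\dots,N_k$ on $E$ such that the polytopes $B(N_1),\dots,B(N_k)$ form a polytopal subdivision of $B(N)$ (their union is $B(N)$ and any two of them intersect in a common proper face of both) and each $N_i$ has the same partition of $E$ into connected components as $N$ (equivalently, for connected $N$, each $B(N_i)$ has the same dimension as $B(N)$). *)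

theory Defs
  imports "HOL-Analysis.Analysis"
begin

text \<open>
  A matroid is represented by its family of bases. Its ground set is the whole of the finite
  type \<open>'e\<close>, so that \<open>real ^ 'e\<close> is the space containing the base polytope.
\<close>

definition matroid_bases :: "'e::finite set set \<Rightarrow> bool" where
  "matroid_bases \<B> \<longleftrightarrow>
     \<B> \<noteq> {} \<and>
     (\<forall>X\<in>\<B>. \<forall>Y\<in>\<B>. \<forall>x\<in>X - Y. \<exists>y\<in>Y - X. insert y (X - {x}) \<in> \<B>)"

definition indep :: "'e::finite set set \<Rightarrow> 'e set \<Rightarrow> bool" where
  "indep \<B> I \<longleftrightarrow> (\<exists>B\<in>\<B>. I \<subseteq> B)"

definition circuit :: "'e::finite set set \<Rightarrow> 'e set \<Rightarrow> bool" where
  "circuit \<B> C \<longleftrightarrow> \<not> indep \<B> C \<and> (\<forall>D. D \<subset> C \<longrightarrow> indep \<B> D)"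

text \<open>
  For a matroid, ``equal or contained in a common circuit'' is an equivalence relation, whose
  classes are the connected components; loops and coloops form singleton classes.
\<close>

definition connected_rel :: "'e::finite set set \<Rightarrow> ('e \<times> 'e) set" where
  "connected_rel \<B> = {(x, y). x = y \<or> (\<exists>C. circuit \<B> C \<and> x \<in> C \<and> y \<in> C)}"

definition connected_components :: "'e::finite set set \<Rightarrow> 'e set set" where
  "connected_components \<B> = UNIV // connected_rel \<B>"

definition incidence_vector :: "'e::finite set \<Rightarrow> real ^ 'e" where
  "incidence_vector B = (\<chi> x. if x \<in> B then 1 else 0)"

definition base_polytope :: "'e::finite set set \<Rightarrow> (real ^ 'e) set" where
  "base_polytope \<B> = convex hull (incidence_vector ` \<B>)"

text \<open>
  As usual for polytopal subdivisions, the empty set counts as a proper face, so two cells are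
  allowed to be disjoint.
\<close>

definition proper_face :: "(real ^ 'e::finite) set \<Rightarrow> (real ^ 'e) set \<Rightarrow> bool" where
  "proper_face F P \<longleftrightarrow> F face_of P \<and> F \<noteq> P"

definition decomposable :: "'e::finite set set \<Rightarrow> bool" where
  "decomposable \<B> \<longleftrightarrow>
     (\<exists>k::nat. \<exists>N :: nat \<Rightarrow> 'e set set.
        2 \<le> k \<and>
        (\<forall>i<k. matroid_bases (N i)) \<and>
        (\<Union>i<k. base_polytope (N i)) = base_polytope \<B> \<and>
        (\<forall>i<k. \<forall>j<k. i \<noteq> j \<longrightarrow>
           proper_face (base_polytope (N i) \<inter> base_polytope (N j)) (base_polytope (N i)) \<and>
           proper_face (base_polytope (N i) \<inter> base_polytope (N j)) (base_polytope (N j))) \<and>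
        (\<forall>i<k. connected_components (N i) = connected_components \<B>))"

datatype ground = Ea | Eb | Ec | Ed | Ee | Ef | Eg | Eh | Ei

lemma UNIV_ground: "(UNIV :: ground set) = {Ea, Eb, Ec, Ed, Ee, Ef, Eg, Eh, Ei}"
  using ground.exhaust by auto

instance ground :: finite
  by standard (simp add: UNIV_ground)

definition M_lines :: "ground set set" where
  "M_lines = {{Eb, Ed, Ef, Eh}, {Ea, Eb, Ec}, {Ea, Ed, Ee}, {Ea, Ef, Eg}, {Ea, Eh, Ei},
              {Eb, Eg, Ei}, {Ec, Ed, Ei}, {Ec, Ee, Ef}, {Ee, Eg, Eh}}"

definition M_bases :: "ground set set" where
  "M_bases = {B. card B = 3 \<and> (\<forall>F\<in>M_lines. card (B \<inter> F) \<le> 2)}"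

lemma M_lines_meet:
  assumes "F \<in> M_lines" "G \<in> M_lines" "p \<in> F" "q \<in> F" "p \<in> G" "q \<in> G" "p \<noteq> q"
  shows "F = G"
proof -
  have "\<forall>F\<in>M_lines. \<forall>G\<in>M_lines. \<forall>p\<in>F. \<forall>q\<in>F. p \<in> G \<longrightarrow> q \<in> G \<longrightarrow> p \<noteq> q \<longrightarrow> F = G"
    unfolding M_lines_def by simp
  then show ?thesis using assms by blast
qed

lemma M_bases_iff: "B \<in> M_bases \<longleftrightarrow> card B = 3 \<and> (\<forall>F\<in>M_lines. \<not> B \<subseteq> F)"
proof -
  have "card (B \<inter> F) \<le> 2 \<longleftrightarrow> \<not> B \<subseteq> F" if "card B = 3" for F
  proof
    assume "card (B \<inter> F) \<le> 2"
    then show "\<not> B \<subseteq> F" using that by (auto simp: Int_absorb2)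
  next
    assume "\<not> B \<subseteq> F"
    then have "card (B \<inter> F) < card B" by (intro psubset_card_mono) auto
    then show "card (B \<inter> F) \<le> 2" using that by simp
  qed
  then show ?thesis unfolding M_bases_def by blast
qed

text \<open>The family is indeed the family of bases of a matroid, and its bases have three elements.\<close>

lemma matroid_bases_M: "matroid_bases M_bases"
  unfolding matroid_bases_def
proof (intro conjI ballI)
  have "{Ea, Eb, Ed} \<in> M_bases" unfolding M_bases_iff by (simp add: M_lines_def)
  then show "M_bases \<noteq> {}" by blast
next
  fix X Y x assume X: "X \<in> M_bases" and Y: "Y \<in> M_bases" and x: "x \<in> X - Y"
  have "card (X - {x}) = 2" using X x by (simp add: M_bases_iff)
  then obtain p q where pq: "X - {x} = {p, q}" "p \<noteq> q" by (auto simp: card_2_iff)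
  have "card Y = 3" using Y by (simp add: M_bases_iff)
  show "\<exists>y\<in>Y - X. insert y (X - {x}) \<in> M_bases"
  proof (rule ccontr)
    assume no: "\<not> ?thesis"
    have line: "\<exists>F\<in>M_lines. insert y {p, q} \<subseteq> F" if "y \<in> Y" "y \<notin> {p, q}" for y
    proof -
      have "y \<in> Y - X" using that pq x by auto
      then have "insert y {p, q} \<notin> M_bases" using no pq by auto
      moreover have "card (insert y {p, q}) = 3" using that pq by simp
      ultimately show ?thesis unfolding M_bases_iff by blast
    qed
    have "\<not> Y \<subseteq> {p, q}"
      using card_mono[of "{p, q}" Y] \<open>card Y = 3\<close> pq by auto
    then obtain z where "z \<in> Y" "z \<notin> {p, q}" by blast
    then obtain F where F: "F \<in> M_lines" "p \<in> F" "q \<in> F" using line by blast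
    have "Y \<subseteq> F"
    proof
      fix y assume "y \<in> Y"
      show "y \<in> F"
      proof (cases "y \<in> {p, q}")
        case False
        then obtain G where "G \<in> M_lines" "insert y {p, q} \<subseteq> G" using line \<open>y \<in> Y\<close> by blast
        then show ?thesis using M_lines_meet[of F G p q] F pq(2) by auto
      qed (use F in auto)
    qed
    then show False using Y F by (auto simp: M_bases_iff)
  qed
qed

end

(*
  If the six sets {p} + {two of q, r, s, t} are all bases of M, they span an octahedral face of the
  base polytope. A subdivision either leaves this octahedron whole or splits it in one of three
  ways, "qr|st" meaning that no cell contains both {p, q, r} and {p, s, t}. Looking at the cells
  close to the centre of an octahedron gives tree-like rules for the splits on five points; in
  particular the splits do not change when a point t is moved on the line pt, nor when p and t are
  exchanged while q, r, s are collinear. In M these two moves connect all octahedra, so every split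
  is carried to the five octahedra with p = c, where each of the three types contradicts the tree
  rules. Hence all octahedra stay whole. On the other hand a cell different from M is a connected
  matroid N whose bases form a proper subset of those of M, and such an N cuts through some
  octahedron of M.
*)
theory Submission
  imports Defs
begin

section \<open>Subdivisions of base polytopes\<close>

text \<open>If all bases had smaller weight than \<open>x\<close>, an open half-space avoiding
  \<open>x\<close> would contain the hull. Suitable weights \<open>w\<close> turn membership of a
  point in a cell into the presence of certain bases in that cell.\<close>

lemma base_polytope_weight:
  fixes w :: "'e::finite \<Rightarrow> real"
  assumes "x \<in> base_polytope \<B>"
  obtains B where "B \<in> \<B>" "(\<Sum>e\<in>UNIV. w e * x $ e) \<le> sum w B"
proof -
  define a :: "real ^ 'e" where "a = (\<chi> e. w e)"
  have a: "a \<bullet> v = (\<Sum>e\<in>UNIV. w e * v $ e)" for v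
    by (simp add: a_def inner_vec_def)
  have inc: "a \<bullet> incidence_vector B = sum w B" for B
    by (simp add: a incidence_vector_def if_distrib sum.If_cases cong: if_cong)
  have "\<exists>B\<in>\<B>. a \<bullet> x \<le> sum w B"
  proof (rule ccontr)
    assume "\<not> ?thesis"
    then have "incidence_vector ` \<B> \<subseteq> {v. a \<bullet> v < a \<bullet> x}"
      by (auto simp: inc)
    then have "base_polytope \<B> \<subseteq> {v. a \<bullet> v < a \<bullet> x}"
      unfolding base_polytope_def by (rule hull_minimal) (rule convex_halfspace_lt)
    then show False using assms by auto
  qed
  then show ?thesis using that a by metis
qed

text \<open>The weight that is 1 on \<open>B\<close> and -1 off \<open>B\<close> has value
  \<open>card B\<close> at the incidence vector of \<open>B\<close>, and the only set attaining this
  value is \<open>B\<close> itself.\<close>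

lemma incidence_vector_in_base_polytope_iff:
  "incidence_vector B \<in> base_polytope \<B> \<longleftrightarrow> B \<in> \<B>"
proof
  assume "incidence_vector B \<in> base_polytope \<B>"
  then obtain B' where B': "B' \<in> \<B>"
    "(\<Sum>e\<in>UNIV. (if e \<in> B then 1 else -1) * incidence_vector B $ e)
       \<le> (\<Sum>e\<in>B'. if e \<in> B then 1 else (-1::real))"
    by (rule base_polytope_weight)
  have "(\<Sum>e\<in>UNIV. (if e \<in> B then 1 else -1) * incidence_vector B $ e) = real (card B)"
    by (simp add: incidence_vector_def if_distrib sum.If_cases cong: if_cong)
  moreover have "(\<Sum>e\<in>B'. if e \<in> B then 1 else (-1::real)) = real (card (B' \<inter> B)) - real (card (B' - B))"
    by (simp add: sum.If_cases Diff_eq)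
  ultimately have le: "card B + card (B' - B) \<le> card (B' \<inter> B)" using B'(2) by linarith
  moreover have "card (B' \<inter> B) \<le> card B" by (simp add: card_mono)
  ultimately have "card (B' - B) = 0" "card (B' \<inter> B) = card B" by linarith+
  then have "B' - B = {}" "card (B' \<inter> B) = card B" by simp_all
  then have "B' = B" by (metis Diff_eq_empty_iff card_subset_eq finite inf.absorb1)
  then show "B \<in> \<B>" using B' by simp
qed (simp add: base_polytope_def hull_inc)

lemma compact_base_polytope: "compact (base_polytope \<B>)"
  unfolding base_polytope_def by (intro finite_imp_compact_convex_hull) simp

lemma convex_base_polytope: "convex (base_polytope \<B>)"
  unfolding base_polytope_def by simp

text \<open>The cells form a set of base families over a finite type, hence a finite set. For
  \<open>N = N'\<close> the face condition says that a convex set is a face of itself.\<close>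

locale base_polytope_subdivision =
  fixes \<B> :: "'e::finite set set" and \<C> :: "'e set set set"
  assumes cell_matroid: "N \<in> \<C> \<Longrightarrow> matroid_bases N"
    and Union_cells: "(\<Union>N\<in>\<C>. base_polytope N) = base_polytope \<B>"
    and cells_meet_in_face: "\<lbrakk>N \<in> \<C>; N' \<in> \<C>\<rbrakk> \<Longrightarrow>
      base_polytope N \<inter> base_polytope N' face_of base_polytope N"
begin

lemma finite_cells: "finite \<C>"
  by simp

lemma cell_subset: assumes "N \<in> \<C>" shows "N \<subseteq> \<B>"
proof
  fix B assume "B \<in> N"
  then have "incidence_vector B \<in> base_polytope \<B>"
    using assms Union_cells incidence_vector_in_base_polytope_iff by blast
  then show "B \<in> \<B>" by (simp add: incidence_vector_in_base_polytope_iff)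
qed

lemma cell_exchange:
  assumes "N \<in> \<C>" "X \<in> N" "Y \<in> N" "x \<in> X - Y"
  obtains y where "y \<in> Y - X" "insert y (X - {x}) \<in> N"
  using cell_matroid[OF assms(1)] assms(2-) unfolding matroid_bases_def by blast

text \<open>The midpoint lies inside a segment of the polytope of \<open>N'\<close> and also in the
  face shared with \<open>N\<close>; a face meeting an open segment contains its ends.\<close>

lemma cells_agree:
  assumes N: "N \<in> \<C>" and N': "N' \<in> \<C>" and B: "B1 \<in> N'" "B2 \<in> N'"
    and mid: "midpoint (incidence_vector B1) (incidence_vector B2) \<in> base_polytope N"
  shows "B1 \<in> N"
proof (cases "B1 = B2")
  case True
  then show ?thesis using mid by (simp add: incidence_vector_in_base_polytope_iff)
next
  case False
  let ?v = "incidence_vector :: 'e set \<Rightarrow> real ^ 'e"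
  let ?m = "midpoint (?v B1) (?v B2)"
  have v: "?v B1 \<in> base_polytope N'" "?v B2 \<in> base_polytope N'"
    using B by (simp_all add: incidence_vector_in_base_polytope_iff)
  have ne: "?v B1 \<noteq> ?v B2"
  proof
    assume "?v B1 = ?v B2"
    then have "(if e \<in> B1 then 1 else 0) = (if e \<in> B2 then 1 else (0::real))" for e
      unfolding incidence_vector_def vec_eq_iff by simp
    then have "e \<in> B1 \<longleftrightarrow> e \<in> B2" for e by (metis zero_neq_one)
    with False show False by blast
  qed
  have "?m \<in> base_polytope N'"
    using midpoints_in_convex_hull v by (metis base_polytope_def)
  moreover have "?m \<in> open_segment (?v B1) (?v B2)"
    using ne by simp
  ultimately have "?v B1 \<in> base_polytope N' \<inter> base_polytope N"
    using cells_meet_in_face[OF N' N] v mid unfolding face_of_def by blast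
  then show ?thesis by (simp add: incidence_vector_in_base_polytope_iff)
qed

text \<open>Among the points with parameter 1/(n+2) on the way from \<open>x\<close> to
  \<open>y\<close>, infinitely many lie in one of the finitely many cells. That cell is closed, so
  it contains the limit \<open>x\<close>.\<close>

lemma cell_of_direction:
  assumes x: "x \<in> base_polytope \<B>" and y: "y \<in> base_polytope \<B>"
  obtains N \<epsilon> where "N \<in> \<C>" "0 < \<epsilon>" "\<epsilon> < 1" "x \<in> base_polytope N"
    "(1 - \<epsilon>) *\<^sub>R x + \<epsilon> *\<^sub>R y \<in> base_polytope N"
proof -
  define \<epsilon> :: "nat \<Rightarrow> real" where "\<epsilon> n = inverse (real (Suc (Suc n)))" for n
  define z where "z n = (1 - \<epsilon> n) *\<^sub>R x + \<epsilon> n *\<^sub>R y" for n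
  have eps: "0 < \<epsilon> n" "\<epsilon> n < 1" for n
    by (simp_all add: \<epsilon>_def divide_simps)
  have "z n \<in> base_polytope \<B>" for n
    unfolding z_def using convexD_alt[OF convex_base_polytope x y] eps[of n] by simp
  then have "\<exists>N\<in>\<C>. z n \<in> base_polytope N" for n
    using Union_cells by blast
  then obtain f where f: "f n \<in> \<C>" "z n \<in> base_polytope (f n)" for n by metis
  have "finite (range f)" using f(1) by (meson finite_cells finite_subset image_subsetI)
  then obtain m where inf: "infinite {n \<in> UNIV. f n = f m}"
    using pigeonhole_infinite[of UNIV f] by auto
  have "\<epsilon> \<longlonglongrightarrow> 0"
    unfolding \<epsilon>_def using LIMSEQ_inverse_real_of_nat by (rule LIMSEQ_Suc)
  then have "z \<longlonglongrightarrow> (1 - 0) *\<^sub>R x + 0 *\<^sub>R y"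
    unfolding z_def by (intro tendsto_intros)
  then have lim: "z \<longlonglongrightarrow> x" by simp
  have "x \<in> base_polytope (f m)"
  proof (rule ccontr)
    assume "x \<notin> base_polytope (f m)"
    then have "\<forall>\<^sub>F n in sequentially. z n \<in> - base_polytope (f m)"
      using lim compact_imp_closed[OF compact_base_polytope]
      by (intro topological_tendstoD) auto
    then obtain n0 where n0: "\<And>n. n \<ge> n0 \<Longrightarrow> z n \<notin> base_polytope (f m)"
      unfolding eventually_sequentially by auto
    obtain n where "n \<ge> n0" "f n = f m"
      using inf unfolding infinite_nat_iff_unbounded_le by auto
    then show False using n0 f(2)[of n] by auto
  qed
  then show ?thesis using that[of "f m" "\<epsilon> m"] f eps[of m] unfolding z_def by blast
qed

end

section \<open>Splits of octahedra in rank three\<close>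

locale rank3_subdivision = base_polytope_subdivision \<B> \<C>
  for \<B> :: "'e::finite set set" and \<C> :: "'e set set set" +
  assumes card_base: "B \<in> \<B> \<Longrightarrow> card B = 3"
begin

definition octahedron :: "'e \<Rightarrow> 'e \<Rightarrow> 'e \<Rightarrow> 'e \<Rightarrow> 'e \<Rightarrow> bool" where
  "octahedron p q r s t \<longleftrightarrow> {p, q, r} \<in> \<B> \<and> {p, q, s} \<in> \<B> \<and> {p, q, t} \<in> \<B> \<and>
     {p, r, s} \<in> \<B> \<and> {p, r, t} \<in> \<B> \<and> {p, s, t} \<in> \<B>"

text \<open>No octahedron is presupposed: the condition holds trivially if one of the two triples is
  not a base. Such degenerate splits are what allows points to be moved along lines.\<close>

definition split :: "'e \<Rightarrow> 'e \<Rightarrow> 'e \<Rightarrow> 'e \<Rightarrow> 'e \<Rightarrow> bool" where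
  "split p q r s t \<longleftrightarrow> (\<forall>N\<in>\<C>. \<not> ({p, q, r} \<in> N \<and> {p, s, t} \<in> N))"

lemma distinct_base: "{x, y, z} \<in> \<B> \<Longrightarrow> distinct [x, y, z]"
  using card_base[of "{x, y, z}"] by (auto simp: card_insert_if split: if_splits)

lemma cell_baseE:
  assumes "N \<in> \<C>" "B \<in> N"
  obtains x y z where "B = {x, y, z}" "distinct [x, y, z]"
proof -
  have "card B = 3" using assms cell_subset card_base by blast
  then show ?thesis using that by (auto simp: card_3_iff)
qed

lemma octahedron_distinct: "octahedron p q r s t \<Longrightarrow> distinct [p, q, r, s, t]"
  unfolding octahedron_def by (auto dest!: distinct_base)

lemma octahedron_commute:
  "octahedron p r q s t \<longleftrightarrow> octahedron p q r s t"
  "octahedron p q s r t \<longleftrightarrow> octahedron p q r s t"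
  "octahedron p q r t s \<longleftrightarrow> octahedron p q r s t"
  unfolding octahedron_def by (auto simp: insert_commute)

lemma split_commute:
  "split p r q s t \<longleftrightarrow> split p q r s t"
  "split p q r t s \<longleftrightarrow> split p q r s t"
  "split p s t q r \<longleftrightarrow> split p q r s t"
  "split p r q t s \<longleftrightarrow> split p q r s t"
  "split p t s q r \<longleftrightarrow> split p q r s t"
  "split p s t r q \<longleftrightarrow> split p q r s t"
  "split p t s r q \<longleftrightarrow> split p q r s t"
  unfolding split_def by (auto simp: insert_commute)

section \<open>Centres of octahedra and the cells through them\<close>

definition octahedron_center :: "'e \<Rightarrow> 'e \<Rightarrow> 'e \<Rightarrow> 'e \<Rightarrow> 'e \<Rightarrow> real ^ 'e" where
  "octahedron_center p q r s t =
     (\<chi> e. if e = p then 1 else if e \<in> {q, r, s, t} then 1/2 else 0)"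

lemma octahedron_center_eq_midpoint:
  assumes "distinct [p, q, r, s, t]"
  shows "midpoint (incidence_vector {p, q, r}) (incidence_vector {p, s, t}) = octahedron_center p q r s t"
    "midpoint (incidence_vector {p, q, s}) (incidence_vector {p, r, t}) = octahedron_center p q r s t"
    "midpoint (incidence_vector {p, q, t}) (incidence_vector {p, r, s}) = octahedron_center p q r s t"
  using assms by (auto simp: midpoint_def incidence_vector_def octahedron_center_def vec_eq_iff)

lemma weight_of_octahedron_center:
  fixes w :: "'e \<Rightarrow> real"
  assumes "distinct [p, q, r, s, t]"
  shows "(\<Sum>e\<in>UNIV. w e * octahedron_center p q r s t $ e) = w p + (w q + w r + w s + w t) / 2"
proof -
  have "(\<Sum>e\<in>UNIV. w e * octahedron_center p q r s t $ e)
      = (\<Sum>e\<in>{p, q, r, s, t}. w e * octahedron_center p q r s t $ e)"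
    by (rule sum.mono_neutral_right) (auto simp: octahedron_center_def)
  then show ?thesis using assms by (auto simp: octahedron_center_def field_simps)
qed

lemma octahedron_center_in_base_polytope:
  assumes "octahedron p q r s t"
  shows "octahedron_center p q r s t \<in> base_polytope \<B>"
proof -
  have "incidence_vector {p, q, r} \<in> base_polytope \<B>" "incidence_vector {p, s, t} \<in> base_polytope \<B>"
    using assms by (simp_all add: octahedron_def incidence_vector_in_base_polytope_iff)
  then have "midpoint (incidence_vector {p, q, r}) (incidence_vector {p, s, t}) \<in> base_polytope \<B>"
    unfolding base_polytope_def by (metis midpoints_in_convex_hull)
  then show ?thesis
    using octahedron_center_eq_midpoint(1)[OF octahedron_distinct[OF assms]] by simp
qed

text \<open>Without the split some cell contains both ends of this diagonal. The centre is their
  midpoint, so \<open>cells_agree\<close> passes both ends on to every cell through the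
  centre.\<close>

lemma diagonal_in_cell:
  assumes "octahedron_center p q r s t \<in> base_polytope N" "N \<in> \<C>"
    and "distinct [p, q, r, s, t]"
    and "\<not> split p q r s t"
  shows "{p, q, r} \<in> N" "{p, s, t} \<in> N"
proof -
  obtain N' where N': "N' \<in> \<C>" "{p, q, r} \<in> N'" "{p, s, t} \<in> N'"
    using assms(4) unfolding split_def by blast
  have "midpoint (incidence_vector {p, q, r}) (incidence_vector {p, s, t}) \<in> base_polytope N"
    using octahedron_center_eq_midpoint(1)[OF assms(3)] assms(1) by simp
  then show "{p, q, r} \<in> N" "{p, s, t} \<in> N"
    using cells_agree[OF assms(2) N'(1)] N' by (metis midpoint_sym)+
qed

lemma octahedron_center_commute:
  "octahedron_center p r q s t = octahedron_center p q r s t"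
  "octahedron_center p q s r t = octahedron_center p q r s t"
  "octahedron_center p q r t s = octahedron_center p q r s t"
  unfolding octahedron_center_def by (auto simp: vec_eq_iff)

text \<open>The centre has coordinate 1 at \<open>p\<close> and 1/2 at \<open>t\<close>, so a cell
  through it has a vertex of the octahedron with \<open>t\<close> and one without
  \<open>t\<close>.\<close>

lemma vertex_in_cell:
  assumes c: "octahedron_center p q r s t \<in> base_polytope N" and N: "N \<in> \<C>"
    and d: "distinct [p, q, r, s, t]"
  shows "{p, q, t} \<in> N \<or> {p, r, t} \<in> N \<or> {p, s, t} \<in> N"
    "{p, q, r} \<in> N \<or> {p, q, s} \<in> N \<or> {p, r, s} \<in> N"
proof -
  \<comment> \<open>The centre has weight 5/2, and only \<open>p\<close> and \<open>t\<close>
    together with one of \<open>q\<close>, \<open>r\<close>, \<open>s\<close> exceed it, with weight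
    3. The value -10 excludes all points outside the octahedron.\<close>
  define w :: "'e \<Rightarrow> real" where
    "w e = (if e = p then 2 else if e = t then 1 else if e \<in> {q, r, s} then 0 else -10)" for e
  obtain B where B: "B \<in> N" "(\<Sum>e\<in>UNIV. w e * octahedron_center p q r s t $ e) \<le> sum w B"
    using base_polytope_weight[OF c] by blast
  obtain x y z where xyz: "B = {x, y, z}" "distinct [x, y, z]"
    by (rule cell_baseE[OF N B(1)])
  have "w p + (w q + w r + w s + w t) / 2 \<le> w x + w y + w z"
    using B(2) xyz by (simp add: weight_of_octahedron_center[OF d] algebra_simps)
  moreover have "w p + (w q + w r + w s + w t) / 2 = 5/2"
    using d by (auto simp: w_def)
  ultimately have "5/2 \<le> w x + w y + w z" by simp
  then have "B = {p, q, t} \<or> B = {p, r, t} \<or> B = {p, s, t}"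
    using xyz d by (auto simp: w_def insert_commute split: if_splits)
  then show "{p, q, t} \<in> N \<or> {p, r, t} \<in> N \<or> {p, s, t} \<in> N" using B(1) by blast
next
  define w :: "'e \<Rightarrow> real" where
    "w e = (if e = p then 3 else if e = t then 0 else if e \<in> {q, r, s} then 1 else -10)" for e
  obtain B where B: "B \<in> N" "(\<Sum>e\<in>UNIV. w e * octahedron_center p q r s t $ e) \<le> sum w B"
    using base_polytope_weight[OF c] by blast
  obtain x y z where xyz: "B = {x, y, z}" "distinct [x, y, z]"
    by (rule cell_baseE[OF N B(1)])
  have "w p + (w q + w r + w s + w t) / 2 \<le> w x + w y + w z"
    using B(2) xyz by (simp add: weight_of_octahedron_center[OF d] algebra_simps)
  moreover have "w p + (w q + w r + w s + w t) / 2 = 9/2"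
    using d by (auto simp: w_def)
  ultimately have "9/2 \<le> w x + w y + w z" by simp
  then have "B = {p, q, r} \<or> B = {p, q, s} \<or> B = {p, r, s}"
    using xyz d by (auto simp: w_def insert_commute split: if_splits)
  then show "{p, q, r} \<in> N \<or> {p, q, s} \<in> N \<or> {p, r, s} \<in> N" using B(1) by blast
qed

lemma vertex_exchange:
  assumes N: "N \<in> \<C>" and d: "distinct [p, q, r, s, t]"
    and "{p, q, r} \<in> N" "{p, s, t} \<in> N"
  shows "{p, r, s} \<in> N \<or> {p, r, t} \<in> N"
proof -
  obtain y where "y \<in> {p, s, t} - {p, q, r}" "insert y ({p, q, r} - {q}) \<in> N"
    by (rule cell_exchange[OF N assms(3,4), of q]) (use d in auto)
  moreover have "{p, q, r} - {q} = {p, r}" using d by auto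
  ultimately show ?thesis by (auto simp: insert_commute)
qed

text \<open>One vertex from each antipodal pair spans only a triangle, which misses the centre, so a
  cell through the centre has both ends of some diagonal. If two diagonals are excluded it is the
  third, and exchange between its ends then completes an excluded one.\<close>

lemma split_unique:
  assumes o: "octahedron p q r s t" and "split p q r s t"
  shows "\<not> split p q s r t"
proof
  assume s2: "split p q s r t"
  note d = octahedron_distinct[OF o]
  obtain N where N: "N \<in> \<C>" and c: "octahedron_center p q r s t \<in> base_polytope N"
    using octahedron_center_in_base_polytope[OF o] Union_cells by blast
  have n: "\<not> ({p, q, r} \<in> N \<and> {p, s, t} \<in> N)" "\<not> ({p, q, s} \<in> N \<and> {p, r, t} \<in> N)"
    using assms(2) s2 N unfolding split_def by blast+
  \<comment> \<open>For each of \<open>t\<close>, \<open>s\<close>, \<open>r\<close>,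
    \<open>q\<close> in turn, a vertex containing it and a vertex avoiding it.\<close>
  have v: "{p, q, t} \<in> N \<or> {p, r, t} \<in> N \<or> {p, s, t} \<in> N"
    "{p, q, r} \<in> N \<or> {p, q, s} \<in> N \<or> {p, r, s} \<in> N"
    "{p, q, s} \<in> N \<or> {p, r, s} \<in> N \<or> {p, s, t} \<in> N"
    "{p, q, r} \<in> N \<or> {p, q, t} \<in> N \<or> {p, r, t} \<in> N"
    "{p, q, r} \<in> N \<or> {p, r, s} \<in> N \<or> {p, r, t} \<in> N"
    "{p, q, s} \<in> N \<or> {p, q, t} \<in> N \<or> {p, s, t} \<in> N"
    "{p, q, r} \<in> N \<or> {p, q, s} \<in> N \<or> {p, q, t} \<in> N"
    "{p, r, s} \<in> N \<or> {p, r, t} \<in> N \<or> {p, s, t} \<in> N"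
    using vertex_in_cell[of p q r s t N] vertex_in_cell[of p q r t s N]
      vertex_in_cell[of p q s t r N] vertex_in_cell[of p r s t q N] c N d
    by (auto simp: octahedron_center_commute insert_commute)
  have e: "{p, q, t} \<in> N \<Longrightarrow> {p, r, s} \<in> N \<Longrightarrow> ({p, q, r} \<in> N \<or> {p, q, s} \<in> N)
     \<and> ({p, r, t} \<in> N \<or> {p, s, t} \<in> N) \<and> ({p, q, r} \<in> N \<or> {p, r, t} \<in> N) \<and> ({p, q, s} \<in> N \<or> {p, s, t} \<in> N)"
    using vertex_exchange[OF N, of p q t r s] vertex_exchange[OF N, of p t q r s]
      vertex_exchange[OF N, of p r s q t] vertex_exchange[OF N, of p s r q t] d
    by (auto simp: insert_commute)
  show False using n v e by blast
qed


section \<open>Cells close to a centre and the tree rules for splits\<close>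

lemma cell_near_center:
  assumes o: "octahedron p q r s t" and B: "B \<in> \<B>"
  obtains N where "N \<in> \<C>" "octahedron_center p q r s t \<in> base_polytope N"
    "\<And>w :: 'e \<Rightarrow> real. w p + (w q + w r + w s + w t) / 2 < sum w B \<Longrightarrow>
       \<exists>x y z. {x, y, z} \<in> N \<and> distinct [x, y, z] \<and>
         w p + (w q + w r + w s + w t) / 2 < w x + w y + w z"
proof -
  let ?c = "octahedron_center p q r s t" and ?v = "incidence_vector B :: real ^ 'e"
  obtain N \<epsilon> where N: "N \<in> \<C>" and eps: "0 < \<epsilon>" "\<epsilon> < 1" and c: "?c \<in> base_polytope N"
    and z: "(1 - \<epsilon>) *\<^sub>R ?c + \<epsilon> *\<^sub>R ?v \<in> base_polytope N"
    using cell_of_direction[OF octahedron_center_in_base_polytope[OF o]] B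
      incidence_vector_in_base_polytope_iff by metis
  \<comment> \<open>The displaced point has a weight strictly between those of the centre and of
    \<open>B\<close>, and some base of \<open>N\<close> is at least as heavy. Since \<open>N\<close>
    is fixed before \<open>w\<close>, one cell serves all weights.\<close>
  have "\<exists>x y z. {x, y, z} \<in> N \<and> distinct [x, y, z] \<and>
         w p + (w q + w r + w s + w t) / 2 < w x + w y + w z"
    if w: "w p + (w q + w r + w s + w t) / 2 < sum w B" for w :: "'e \<Rightarrow> real"
  proof -
    let ?m = "w p + (w q + w r + w s + w t) / 2"
    have v: "(\<Sum>e\<in>UNIV. w e * ?v $ e) = sum w B"
      by (simp add: incidence_vector_def if_distrib sum.If_cases cong: if_cong)
    have "(\<Sum>e\<in>UNIV. w e * ((1 - \<epsilon>) *\<^sub>R ?c + \<epsilon> *\<^sub>R ?v) $ e)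
        = (\<Sum>e\<in>UNIV. (1 - \<epsilon>) * (w e * ?c $ e) + \<epsilon> * (w e * ?v $ e))"
      by (rule sum.cong) (simp_all add: algebra_simps)
    also have "\<dots> = (1 - \<epsilon>) * (\<Sum>e\<in>UNIV. w e * ?c $ e) + \<epsilon> * (\<Sum>e\<in>UNIV. w e * ?v $ e)"
      by (simp only: sum.distrib sum_distrib_left)
    also have "\<dots> = (1 - \<epsilon>) * ?m + \<epsilon> * sum w B"
      unfolding v weight_of_octahedron_center[OF octahedron_distinct[OF o]] ..
    also have "\<dots> = ?m + \<epsilon> * (sum w B - ?m)"
    proof -
      have "(1 - \<epsilon>) * m + \<epsilon> * b = m + \<epsilon> * (b - m)" for m b :: real
        by (simp add: algebra_simps)
      then show ?thesis .
    qed
    finally have "(\<Sum>e\<in>UNIV. w e * ((1 - \<epsilon>) *\<^sub>R ?c + \<epsilon> *\<^sub>R ?v) $ e)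
        = ?m + \<epsilon> * (sum w B - ?m)" .
    moreover have "\<epsilon> * (sum w B - ?m) > 0" using w eps by simp
    moreover obtain B' where B': "B' \<in> N"
      "(\<Sum>e\<in>UNIV. w e * ((1 - \<epsilon>) *\<^sub>R ?c + \<epsilon> *\<^sub>R ?v) $ e) \<le> sum w B'"
      using base_polytope_weight[OF z] by blast
    ultimately have "?m < sum w B'" by linarith
    moreover obtain x y z where "B' = {x, y, z}" "distinct [x, y, z]"
      by (rule cell_baseE[OF N B'(1)])
    ultimately have "{x, y, z} \<in> N \<and> distinct [x, y, z] \<and> ?m < w x + w y + w z"
      using B'(1) by (auto simp: algebra_simps)
    then show ?thesis by blast
  qed
  then show ?thesis using that N c by blast
qed

text \<open>In the next two lemmas \<open>w\<close> exceeds its value at the centre only on bases of the desired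
  kind.\<close>

lemma cell_near_center_through:
  assumes o: "octahedron p q r s u" and t: "{p, t, x} \<in> \<B>" "x \<in> {q, r, s, u}" "t \<notin> {q, r, s, u}"
  obtains N where "N \<in> \<C>" "octahedron_center p q r s u \<in> base_polytope N"
    "{p, q, t} \<in> N \<or> {p, r, t} \<in> N \<or> {p, s, t} \<in> N \<or> {p, u, t} \<in> N"
proof -
  note d = octahedron_distinct[OF o] distinct_base[OF t(1)]
  define w :: "'e \<Rightarrow> real" where
    "w e = (if e = p then 2 else if e = t then 1 else if e \<in> {q, r, s, u} then 0 else -10)" for e
  obtain N where N: "N \<in> \<C>" "octahedron_center p q r s u \<in> base_polytope N"
    "\<And>w :: 'e \<Rightarrow> real. w p + (w q + w r + w s + w u) / 2 < sum w {p, t, x} \<Longrightarrow>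
       \<exists>x y z. {x, y, z} \<in> N \<and> distinct [x, y, z] \<and>
         w p + (w q + w r + w s + w u) / 2 < w x + w y + w z"
    by (rule cell_near_center[OF o t(1)]) blast
  have "w p + (w q + w r + w s + w u) / 2 < sum w {p, t, x}"
    using d t by (auto simp: w_def)
  then obtain x y z where xyz: "{x, y, z} \<in> N" "distinct [x, y, z]" "2 < w x + w y + w z"
    using N(3)[of w] d t by (auto simp: w_def)
  then have "{p, q, t} \<in> N \<or> {p, r, t} \<in> N \<or> {p, s, t} \<in> N \<or> {p, u, t} \<in> N"
    using d by (auto simp: w_def insert_commute split: if_splits)
  then show ?thesis using that N by blast
qed

lemma cell_near_center_avoiding:
  assumes o: "octahedron t q r s u" and B: "B \<in> \<B>" "B \<subseteq> {q, r, s, u}"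
  obtains N where "N \<in> \<C>" "octahedron_center t q r s u \<in> base_polytope N"
    "{q, r, s} \<in> N \<or> {q, r, u} \<in> N \<or> {q, s, u} \<in> N \<or> {r, s, u} \<in> N"
proof -
  note d = octahedron_distinct[OF o]
  define w :: "'e \<Rightarrow> real" where
    "w e = (if e = t then -1 else if e \<in> {q, r, s, u} then 0 else -10)" for e
  obtain N where N: "N \<in> \<C>" "octahedron_center t q r s u \<in> base_polytope N"
    "\<And>w :: 'e \<Rightarrow> real. w t + (w q + w r + w s + w u) / 2 < sum w B \<Longrightarrow>
       \<exists>x y z. {x, y, z} \<in> N \<and> distinct [x, y, z] \<and>
         w t + (w q + w r + w s + w u) / 2 < w x + w y + w z"
    by (rule cell_near_center[OF o B(1)]) blast
  have "sum w B = 0"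
    using d B(2) by (intro sum.neutral) (auto simp: w_def)
  then have "w t + (w q + w r + w s + w u) / 2 < sum w B"
    using d by (auto simp: w_def)
  then obtain x y z where xyz: "{x, y, z} \<in> N" "distinct [x, y, z]" "-1 < w x + w y + w z"
    using N(3)[of w] d by (auto simp: w_def)
  then have "{q, r, s} \<in> N \<or> {q, r, u} \<in> N \<or> {q, s, u} \<in> N \<or> {r, s, u} \<in> N"
    using d by (auto simp: w_def insert_commute split: if_splits)
  then show ?thesis using that N by blast
qed

text \<open>The quartet rule that qr|st and qr|tu imply qr|su. Otherwise a cell near the centre that
  has a base through \<open>p\<close> and \<open>t\<close> contains \<open>{p, q, r}\<close> and
  \<open>{p, s, u}\<close>. The two splits exclude \<open>{p, s, t}\<close> and
  \<open>{p, u, t}\<close>, while \<open>{p, q, t}\<close> or \<open>{p, r, t}\<close> would produce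
  one of these by exchange with \<open>{p, s, u}\<close>.\<close>

lemma split_trans:
  assumes o: "octahedron p q r s u"
    and t: "{p, t, x} \<in> \<B>" "x \<in> {q, r, s, u}" "t \<notin> {q, r, s, u}"
    and s: "split p q r s t" "split p q r t u"
  shows "split p q r s u"
proof (rule ccontr)
  assume ns: "\<not> split p q r s u"
  note d = octahedron_distinct[OF o] distinct_base[OF t(1)]
  obtain N where N: "N \<in> \<C>" "octahedron_center p q r s u \<in> base_polytope N"
    and nt: "{p, q, t} \<in> N \<or> {p, r, t} \<in> N \<or> {p, s, t} \<in> N \<or> {p, u, t} \<in> N"
    by (rule cell_near_center_through[OF o t])
  note diag = diagonal_in_cell[OF N(2,1) d(1) ns]
  have no: "{p, s, t} \<notin> N" "{p, u, t} \<notin> N"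
    using s diag(1) N(1) unfolding split_def by (metis insert_commute)+
  have "{p, x, t} \<notin> N" if x: "x \<in> {q, r}" for x
  proof
    assume "{p, x, t} \<in> N"
    then have "{p, t, s} \<in> N \<or> {p, t, u} \<in> N"
      using vertex_exchange[OF N(1), of p x t s u] diag(2) d t(3) x by auto
    then show False using no by (auto simp: insert_commute)
  qed
  then show False using no nt by auto
qed

text \<open>This is \<open>split_trans\<close> for the dual matroid, in which \<open>{t, q, r}\<close> and \<open>{t, s, u}\<close>
  are the complements of \<open>{s, u}\<close> and \<open>{q, r}\<close> within \<open>{q, r, s, t, u}\<close>.\<close>

lemma split_trans_dual:
  assumes o: "octahedron t q r s u" and B: "B \<in> \<B>" "B \<subseteq> {q, r, s, u}"
    and s: "split u q r s t" "split s q r t u"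
  shows "split t q r s u"
proof (rule ccontr)
  assume ns: "\<not> split t q r s u"
  note d = octahedron_distinct[OF o]
  obtain N where N: "N \<in> \<C>" "octahedron_center t q r s u \<in> base_polytope N"
    and nt: "{q, r, s} \<in> N \<or> {q, r, u} \<in> N \<or> {q, s, u} \<in> N \<or> {r, s, u} \<in> N"
    by (rule cell_near_center_avoiding[OF o B])
  note diag = diagonal_in_cell[OF N(2,1) d(1) ns]
  have no: "{q, r, s} \<notin> N" "{q, r, u} \<notin> N"
    using s diag(2) N(1) unfolding split_def by (metis insert_commute)+
  have "{x, s, u} \<notin> N" if x: "x \<in> {q, r}" for x
  proof
    assume X: "{x, s, u} \<in> N"
    obtain y where "y \<in> {x, s, u} - {t, q, r}" "insert y ({t, q, r} - {t}) \<in> N"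
      by (rule cell_exchange[OF N(1) diag(1) X, of t]) (use d x in auto)
    moreover have "{t, q, r} - {t} = {q, r}" using d by auto
    ultimately show False using no x by (auto simp: insert_commute)
  qed
  then show False using no nt by auto
qed

text \<open>As \<open>{p, t, t'}\<close> is not a base, qr|tt' is a degenerate split, and
  \<open>split_trans\<close> carries qr|st to qr|st'.\<close>

lemma split_parallel:
  assumes o: "octahedron p q r s t" "octahedron p q r s t'" and l: "{p, t, t'} \<notin> \<B>"
  shows "split p q r s t \<longleftrightarrow> split p q r s t'"
proof -
  have *: "split p q r s t'"
    if "octahedron p q r s t" "octahedron p q r s t'" "{p, t, t'} \<notin> \<B>" "split p q r s t" for t t'
  proof (cases "t = t'")
    case False
    have "split p q r t t'"
      using that(3) cell_subset unfolding split_def by blast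
    moreover have "{p, t, q} \<in> \<B>"
      using that(1) by (auto simp: octahedron_def insert_commute)
    moreover have "t \<notin> {q, r, s, t'}"
      using octahedron_distinct[OF that(1)] False by auto
    ultimately show ?thesis using split_trans[OF that(2), of t q] that(4) by simp
  qed (use that in simp)
  show ?thesis using *[of t t'] *[of t' t] assms by (auto simp: insert_commute)
qed

text \<open>As \<open>{q, r, s}\<close> is not a base, \<open>split s q r t u\<close> holds
  trivially and serves as the second input of the dual rule.\<close>

lemma split_swap:
  assumes o: "octahedron t q r s u" "octahedron u q r s t" and l: "{q, r, s} \<notin> \<B>"
  shows "split t q r s u \<longleftrightarrow> split u q r s t"
proof -
  have *: "split t q r s u"
    if "octahedron t q r s u" "octahedron u q r s t" "split u q r s t" for t u
  proof -
    have "split s q r t u"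
      using l cell_subset unfolding split_def by (auto simp: insert_commute)
    moreover have "{u, q, r} \<in> \<B>" "{u, q, r} \<subseteq> {q, r, s, u}"
      using that(2) by (auto simp: octahedron_def)
    ultimately show ?thesis using split_trans_dual[OF that(1)] that(3) by blast
  qed
  show ?thesis using * o by blast
qed

text \<open>The five splits would force \<open>x0\<close> to be a loop in the contraction of \<open>p\<close> of a cell
  that contains a small displacement of the centre towards \<open>x0\<close>.\<close>

lemma no_pentagon_of_splits:
  assumes o: "octahedron p x1 x2 x3 x4"
    and u: "{p, x0, x1} \<in> \<B>" "x0 \<notin> {x1, x2, x3, x4}"
    and s: "split p x1 x4 x2 x3" "split p x2 x0 x3 x4" "split p x3 x1 x4 x0"
      "split p x4 x2 x0 x1" "split p x0 x3 x1 x2"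
  shows False
proof -
  obtain N where N: "N \<in> \<C>" "octahedron_center p x1 x2 x3 x4 \<in> base_polytope N"
    and near: "{p, x1, x0} \<in> N \<or> {p, x2, x0} \<in> N \<or> {p, x3, x0} \<in> N \<or> {p, x4, x0} \<in> N"
    by (rule cell_near_center_through[OF o u(1) _ u(2)]) auto
  note d = octahedron_distinct[OF o]
  \<comment> \<open>By uniqueness x1x4|x2x3 is the only split of this octahedron, so
    \<open>N\<close> contains the other two diagonals.\<close>
  have n: "\<not> split p x1 x2 x3 x4" "\<not> split p x1 x3 x2 x4"
    using split_unique[of p x1 x4 x2 x3] split_unique[of p x1 x4 x3 x2] o s(1)
    by (metis octahedron_commute split_commute)+
  have "{p, x1, x2} \<in> N" "{p, x3, x4} \<in> N"
    using diagonal_in_cell[OF N(2,1) d n(1)] by auto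
  \<comment> \<open>Each of the four remaining splits pairs one of the four triples found in
    \<open>N\<close> with one triple through \<open>p\<close> and \<open>x0\<close>.\<close>
  moreover have "{p, x1, x3} \<in> N" "{p, x2, x4} \<in> N"
    using diagonal_in_cell[of p x1 x3 x2 x4 N] N n(2) d by (auto simp: octahedron_center_commute)
  ultimately have "{p, x2, x0} \<notin> N" "{p, x4, x0} \<notin> N" "{p, x1, x0} \<notin> N" "{p, x3, x0} \<notin> N"
    using s(2-5) N(1) unfolding split_def by (metis insert_commute)+
  then show False using near by blast
qed

section \<open>Profiles: the three possible splits of an octahedron and their behaviour under
  moves\<close>

definition profile :: "'e \<Rightarrow> 'e \<Rightarrow> 'e \<Rightarrow> 'e \<Rightarrow> 'e \<Rightarrow> bool \<times> bool \<times> bool" where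
  "profile p q r s t = (split p q r s t, split p q s r t, split p q t r s)"

lemma profile_parallel4:
  assumes "octahedron p q r s t" "octahedron p q r s t'" "{p, t, t'} \<notin> \<B>"
  shows "profile p q r s t = profile p q r s t'"
  using assms split_parallel[of p q r s t t'] split_parallel[of p q s r t t']
    split_parallel[of p r s q t t'] octahedron_commute(1)[of p q r s]
    octahedron_commute(2)[of p q] octahedron_commute(2)[of p r]
    split_commute(3)[of p r s q t] split_commute(3)[of p r s q t']
  unfolding profile_def by simp

lemma profile_swap4:
  assumes "octahedron p q r s t" "octahedron t q r s p" "{q, r, s} \<notin> \<B>"
  shows "profile p q r s t = profile t q r s p"
proof -
  have "{q, s, r} \<notin> \<B>" "{r, s, q} \<notin> \<B>" using assms(3) by (simp_all add: insert_commute)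
  then show ?thesis
    using assms split_swap[of p q r s t] split_swap[of p q s r t] split_swap[of p r s q t]
      octahedron_commute(1)[of _ q r s]
      octahedron_commute(2)[of _ q] octahedron_commute(2)[of _ r]
      split_commute(3)[of p r s q t] split_commute(3)[of t r s q p]
    unfolding profile_def by simp
qed

text \<open>Reordering the outer points permutes the three entries in a way that does not depend on
  the octahedron, so equalities of profiles survive. This frees the moves from the fourth
  position.\<close>

lemma profile_permute:
  "profile p q r s t = profile p' q' r' s' t' \<Longrightarrow> profile p r q s t = profile p' r' q' s' t'"
  "profile p q r s t = profile p' q' r' s' t' \<Longrightarrow> profile p q s r t = profile p' q' s' r' t'"
  "profile p q r s t = profile p' q' r' s' t' \<Longrightarrow> profile p q r t s = profile p' q' r' t' s'"
proof -
  have e: "profile p r q s t = (case profile p q r s t of (a, b, c) \<Rightarrow> (a, c, b))"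
    "profile p q s r t = (case profile p q r s t of (a, b, c) \<Rightarrow> (b, a, c))"
    "profile p q r t s = (case profile p q r s t of (a, b, c) \<Rightarrow> (a, c, b))" for p q r s t
    unfolding profile_def by (simp_all add: split_commute)
  show "profile p q r s t = profile p' q' r' s' t' \<Longrightarrow> profile p r q s t = profile p' r' q' s' t'"
    by (simp only: e(1)[of p r q s t] e(1)[of p' r' q' s' t'])
  show "profile p q r s t = profile p' q' r' s' t' \<Longrightarrow> profile p q s r t = profile p' q' s' r' t'"
    by (simp only: e(2)[of p q s r t] e(2)[of p' q' s' r' t'])
  show "profile p q r s t = profile p' q' r' s' t' \<Longrightarrow> profile p q r t s = profile p' q' r' t' s'"
    by (simp only: e(3)[of p q r t s] e(3)[of p' q' r' t' s'])
qed

text \<open>The moved point stands in the fourth, third, second and first outer position,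
  respectively.\<close>

lemmas profile_parallel = profile_parallel4
  profile_parallel4[THEN profile_permute(3)]
  profile_parallel4[THEN profile_permute(3), THEN profile_permute(2)]
  profile_parallel4[THEN profile_permute(3), THEN profile_permute(2), THEN profile_permute(1)]

lemmas profile_swap = profile_swap4
  profile_swap4[THEN profile_permute(3)]
  profile_swap4[THEN profile_permute(3), THEN profile_permute(2)]
  profile_swap4[THEN profile_permute(3), THEN profile_permute(2), THEN profile_permute(1)]

definition whole :: "'e \<Rightarrow> 'e set \<Rightarrow> bool" where
  "whole p Q \<longleftrightarrow> (\<exists>N\<in>\<C>. \<forall>q\<in>Q. \<forall>r\<in>Q. q \<noteq> r \<longrightarrow> {p, q, r} \<in> N)"

text \<open>Each unsplit diagonal lies in some cell, a priori a different one for each diagonal;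
  \<open>diagonal_in_cell\<close> places all three in any one cell through the centre.\<close>

lemma whole_iff_profile:
  assumes o: "octahedron p q r s t"
  shows "whole p {q, r, s, t} \<longleftrightarrow> profile p q r s t = (False, False, False)"
proof
  note d = octahedron_distinct[OF o]
  assume "whole p {q, r, s, t}"
  then show "profile p q r s t = (False, False, False)"
    using d unfolding whole_def profile_def split_def by auto
next
  note d = octahedron_distinct[OF o]
  assume "profile p q r s t = (False, False, False)"
  then have ns: "\<not> split p q r s t" "\<not> split p q s r t" "\<not> split p q t r s"
    by (simp_all add: profile_def)
  obtain N where N: "N \<in> \<C>" "octahedron_center p q r s t \<in> base_polytope N"
    using octahedron_center_in_base_polytope[OF o] Union_cells by blast
  have "{p, q, r} \<in> N" "{p, s, t} \<in> N"
    using diagonal_in_cell[OF N(2,1) d ns(1)] by auto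
  moreover have "{p, q, s} \<in> N" "{p, r, t} \<in> N"
    using diagonal_in_cell[of p q s r t N] N d ns(2) by (auto simp: octahedron_center_commute)
  moreover have "octahedron_center p q t r s = octahedron_center p q r s t"
    by (metis octahedron_center_commute)
  then have "{p, q, t} \<in> N" "{p, r, s} \<in> N"
    using diagonal_in_cell[of p q t r s N] N d ns(3) by auto
  ultimately show "whole p {q, r, s, t}"
    unfolding whole_def using N(1) by (intro bexI[of _ N]) (simp_all add: insert_commute)
qed

lemma whole_parallel:
  assumes "octahedron p q r s t" "octahedron p q r s t'" "{p, t, t'} \<notin> \<B>" "whole p {q, r, s, t}"
  shows "whole p {q, r, s, t'}"
  using assms profile_parallel4 whole_iff_profile by metis

lemma whole_swap:
  assumes "octahedron p q r s t" "octahedron t q r s p" "{q, r, s} \<notin> \<B>" "whole p {q, r, s, t}"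
  shows "whole t {q, r, s, p}"
  using assms profile_swap4 whole_iff_profile by metis

end

section \<open>Connected weak images\<close>

lemma matroid_bases_exchange:
  assumes "matroid_bases \<B>" "X \<in> \<B>" "Y \<in> \<B>" "x \<in> X" "x \<notin> Y"
  obtains y where "y \<in> Y" "y \<notin> X" "insert y (X - {x}) \<in> \<B>"
  using assms unfolding matroid_bases_def by blast

text \<open>Without a crossing exchange at one basis, all bases meet \<open>X\<close> in equally many elements, so
  \<open>N\<close> is a direct sum and no circuit meets both \<open>X\<close> and its complement.\<close>

lemma crossing_exchange:
  fixes N :: "'e::finite set set"
  assumes N: "matroid_bases N" and B: "B \<in> N"
    and conn: "(a, b) \<in> connected_rel N" and ab: "a \<in> X" "b \<notin> X"
  shows "\<exists>u v. u \<in> B \<and> v \<notin> B \<and> (u \<in> X \<longleftrightarrow> v \<notin> X) \<and> insert v (B - {u}) \<in> N"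
proof (rule ccontr)
  assume "\<not> ?thesis"
  then have nc: "v \<in> X \<longleftrightarrow> u \<in> X" if "u \<in> B" "v \<notin> B" "insert v (B - {u}) \<in> N" for u v
    using that by blast
  \<comment> \<open>Exchanging any \<open>x\<close> of \<open>B' - B\<close> towards
    \<open>B\<close> yields a basis with the right count by induction. If \<open>B'\<close> itself
    has a wrong count, all these exchanges cross in the same direction, so \<open>B' - B\<close>
    lies on one side of \<open>X\<close> and some \<open>y\<close> of \<open>B - B'\<close> on the
    other. Exchanging \<open>y\<close> out of \<open>B\<close> is then a forbidden crossing.\<close>
  have const: "card (B' \<inter> X) = card (B \<inter> X)" if "B' \<in> N" for B'
    using that
  proof (induction "card (B' - B)" arbitrary: B' rule: less_induct)
    case less
    have step: "\<exists>y\<in>B - B'. card (insert y (B' - {x}) \<inter> X) = card (B \<inter> X)" if x: "x \<in> B' - B" for x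
    proof -
      obtain y where y: "y \<in> B" "y \<notin> B'" "insert y (B' - {x}) \<in> N"
        using matroid_bases_exchange[OF N less.prems B, of x] x by auto
      have "insert y (B' - {x}) - B \<subset> B' - B" using x y by auto
      then have "card (insert y (B' - {x}) - B) < card (B' - B)" by (simp add: psubset_card_mono)
      then show ?thesis using less.hyps y by blast
    qed
    show ?case
    proof (rule ccontr)
      assume ne: "card (B' \<inter> X) \<noteq> card (B \<inter> X)"
      have opp: "\<exists>y\<in>B - B'. (x \<in> X) \<noteq> (y \<in> X) \<and>
          (x \<in> X \<longleftrightarrow> card (B' \<inter> X) > card (B \<inter> X))" if x: "x \<in> B' - B" for x
      proof -
        obtain y where y: "y \<in> B - B'" "card (insert y (B' - {x}) \<inter> X) = card (B \<inter> X)"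
          using step[OF x] by blast
        have count: "card (A \<inter> X) = (\<Sum>e\<in>A. of_bool (e \<in> X))" for A
          by (simp add: of_bool_def sum.If_cases)
        have "card (insert y (B' - {x}) \<inter> X) + of_bool (x \<in> X) = card (B' \<inter> X) + of_bool (y \<in> X)"
          unfolding count using x y(1) sum.remove[of B' x "\<lambda>e. of_bool (e \<in> X) :: nat"] by simp
        then show ?thesis using ne y by (auto simp: of_bool_def split: if_splits)
      qed
      have "\<not> B' \<subseteq> B"
      proof
        assume "B' \<subseteq> B"
        moreover have "B' \<noteq> B" using ne by blast
        ultimately obtain y where "y \<in> B" "y \<notin> B'" by blast
        then show False
          using matroid_bases_exchange[OF N B less.prems] \<open>B' \<subseteq> B\<close> by blast
      qed
      then obtain x where x: "x \<in> B' - B" by blast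
      then obtain y where y: "y \<in> B - B'" "(x \<in> X) \<noteq> (y \<in> X)" using opp by blast
      obtain x' where x': "x' \<in> B'" "x' \<notin> B" "insert x' (B - {y}) \<in> N"
        using matroid_bases_exchange[OF N B less.prems, of y] y by auto
      have "x' \<in> X \<longleftrightarrow> x \<in> X" using opp[of x] opp[of x'] x x' by blast
      then show False using nc[of y x'] x' y by blast
    qed
  qed
  \<comment> \<open>Exchange the elements of \<open>B1\<close> in \<open>X\<close> against
    \<open>B2\<close>. Constancy of the count forces each incoming element into \<open>X\<close>, so
    \<open>B1 - X\<close> survives.\<close>
  have glue: "\<exists>B3\<in>N. (B2 \<inter> X) \<union> (B1 - X) \<subseteq> B3" if B1: "B1 \<in> N" and B2: "B2 \<in> N" for B1 B2
    using B1
  proof (induction "card (B1 \<inter> X - B2)" arbitrary: B1 rule: less_induct)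
    case less
    show ?case
    proof (cases "B1 \<inter> X \<subseteq> B2")
      case True
      have "B1 \<inter> X = B2 \<inter> X"
        using const[OF less.prems] const[OF B2] True
        by (intro card_subset_eq) auto
      then show ?thesis using less.prems by blast
    next
      case False
      then obtain x where x: "x \<in> B1" "x \<in> X" "x \<notin> B2" by blast
      obtain y where y: "y \<in> B2" "y \<notin> B1" "insert y (B1 - {x}) \<in> N"
        by (rule matroid_bases_exchange[OF N less.prems B2 x(1,3)])
      have "y \<in> X"
      proof (rule ccontr)
        assume "y \<notin> X"
        then have "insert y (B1 - {x}) \<inter> X = B1 \<inter> X - {x}" by auto
        moreover have "card (B1 \<inter> X - {x}) < card (B1 \<inter> X)"
          using x by (intro card_Diff1_less) auto
        ultimately show False using const[OF y(3)] const[OF less.prems] by simp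
      qed
      have "card (insert y (B1 - {x}) \<inter> X - B2) \<le> card (B1 \<inter> X - B2 - {x})"
        using y(1) by (intro card_mono) auto
      also have "\<dots> < card (B1 \<inter> X - B2)"
        using x by (intro card_Diff1_less) auto
      finally obtain B3 where "B3 \<in> N" "(B2 \<inter> X) \<union> (insert y (B1 - {x}) - X) \<subseteq> B3"
        using less.hyps y(3) by blast
      then show ?thesis using x \<open>y \<in> X\<close> by blast
    qed
  qed
  obtain C where C: "circuit N C" "a \<in> C" "b \<in> C"
    using conn ab unfolding connected_rel_def by auto
  have "C - {a} \<subset> C" "C - {b} \<subset> C" using C by auto
  then obtain B1 B2 where "B1 \<in> N" "C - {a} \<subseteq> B1" "B2 \<in> N" "C - {b} \<subseteq> B2"
    using C(1) unfolding circuit_def indep_def by meson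
  \<comment> \<open>Since \<open>b\<close> is outside \<open>X\<close>, the part of \<open>C\<close>
    in \<open>X\<close> lies in \<open>B2\<close>; since \<open>a\<close> is in \<open>X\<close>,
    the rest lies in \<open>B1\<close>. So \<open>C\<close> would be independent.\<close>
  then obtain B3 where "B3 \<in> N" "(B2 \<inter> X) \<union> (B1 - X) \<subseteq> B3" using glue by blast
  then have "C \<subseteq> B3" using \<open>C - {a} \<subseteq> B1\<close> \<open>C - {b} \<subseteq> B2\<close> ab by blast
  then show False using C(1) \<open>B3 \<in> N\<close> unfolding circuit_def indep_def by blast
qed

text \<open>Walk from a basis outside \<open>N\<close> towards \<open>B0\<close> by exchanges in
  \<open>M\<close>. The step that enters \<open>N\<close>, read backwards, is the desired
  exchange.\<close>

lemma boundary_basis: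
  assumes M: "matroid_bases M" and "N \<subseteq> M" "N \<noteq> {}" "N \<noteq> M"
  obtains B x y where "B \<in> N" "x \<in> B" "y \<notin> B" "insert y (B - {x}) \<in> M - N"
proof -
  obtain B0 C0 where B0: "B0 \<in> N" and C0: "C0 \<in> M - N" using assms by blast
  have "\<exists>B x y. B \<in> N \<and> x \<in> B \<and> y \<notin> B \<and> insert y (B - {x}) \<in> M - N" if "C \<in> M - N" for C
    using that
  proof (induction "card (C - B0)" arbitrary: C rule: less_induct)
    case less
    have "\<not> C \<subseteq> B0"
    proof
      assume "C \<subseteq> B0"
      moreover have "C \<noteq> B0" using less.prems B0 by blast
      ultimately obtain b where "b \<in> B0" "b \<notin> C" by blast
      then show False
        using matroid_bases_exchange[OF M, of B0 C b] less.prems B0 assms(2) \<open>C \<subseteq> B0\<close> by blast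
    qed
    then obtain c where c: "c \<in> C" "c \<notin> B0" by blast
    obtain y where y: "y \<in> B0" "y \<notin> C" "insert y (C - {c}) \<in> M"
      using matroid_bases_exchange[OF M, of C B0 c] less.prems B0 assms(2) c by blast
    let ?C = "insert y (C - {c})"
    show ?case
    proof (cases "?C \<in> N")
      case True
      have "insert c (?C - {y}) = C" using c y by auto
      then have "insert c (?C - {y}) \<in> M - N" using less.prems by simp
      moreover have "c \<notin> ?C" using c y by auto
      ultimately show ?thesis using True by blast
    next
      case False
      have "?C - B0 \<subset> C - B0" using c y by auto
      then have "card (?C - B0) < card (C - B0)" by (simp add: psubset_card_mono)
      then show ?thesis using less.hyps False y by blast
    qed
  qed
  then show ?thesis using C0 that by blast
qed

lemma exchange_triple:
  assumes "matroid_bases \<B>" "{a, b, c} \<in> \<B>" "Y \<in> \<B>" "a \<notin> Y" "distinct [a, b, c]"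
  obtains y where "y \<in> Y" "{y, b, c} \<in> \<B>"
proof -
  obtain y where "y \<in> Y" "insert y ({a, b, c} - {a}) \<in> \<B>"
    by (rule matroid_bases_exchange[OF assms(1-3), of a]) (use assms in auto)
  moreover have "{a, b, c} - {a} = {b, c}" using assms(5) by auto
  ultimately show ?thesis using that by simp
qed

text \<open>Choose \<open>B \<in> N\<close> and \<open>y \<notin> B\<close> such that \<open>y\<close> can replace \<open>x \<in> B\<close> in \<open>M\<close> but not in \<open>N\<close>. In the
  bipartite graph of the exchanges of \<open>N\<close> at \<open>B\<close> a shortest path from \<open>x\<close> to \<open>y\<close> has three or five
  edges. Three edges give the desired configuration; five are reduced to three by changing
  \<open>x\<close> or \<open>B\<close>.\<close>

lemma weak_image_half_octahedron:
  fixes M N :: "'e::finite set set"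
  assumes M: "matroid_bases M" and N: "matroid_bases N" and sub: "N \<subseteq> M" and ne: "N \<noteq> M"
    and card3: "\<And>B. B \<in> M \<Longrightarrow> card B = 3"
    and conn: "\<And>x y. (x, y) \<in> connected_rel N"
  shows "\<exists>w x u v y. {w, x, u} \<in> N \<and> {w, v, y} \<in> N \<and> {w, u, v} \<in> N \<and> {w, x, y} \<in> N \<and>
    {w, x, v} \<in> N \<and> {w, u, y} \<in> M - N"
proof (rule ccontr)
  assume none: "\<not> ?thesis"
  have dist: "distinct [a, b, c]" if "{a, b, c} \<in> M" for a b c
    using card3[OF that] by (auto simp: card_insert_if split: if_splits)
  \<comment> \<open>The case of a path x - v - u - y at the basis \<open>{x, u, w}\<close>: if
    \<open>y\<close> could not replace \<open>x\<close> in \<open>N\<close>, exchanging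
    \<open>x\<close> out of \<open>{x, y, w}\<close> would give \<open>{v, y, w}\<close> and thus
    the excluded configuration.\<close>
  have no3: "{y, u, w} \<in> N" if b: "{x, u, w} \<in> N" "{v, u, w} \<in> N" "{x, v, w} \<in> N" "{x, y, w} \<in> N"
    "{y, u, w} \<in> M" for x u w v y
  proof (rule ccontr)
    assume no: "{y, u, w} \<notin> N"
    have "x \<notin> {v, u, w}" using b sub dist[of x u w] dist[of x v w] by auto
    then obtain z where "z \<in> {v, u, w}" "{z, y, w} \<in> N"
      using exchange_triple[OF N b(4,2)] dist[of x y w] b(4) sub by blast
    moreover have "{w, y, w} \<notin> M" using dist[of w y w] by auto
    ultimately have "{v, y, w} \<in> N" using no sub by (auto simp: insert_commute)
    then have "{w, x, u} \<in> N \<and> {w, v, y} \<in> N \<and> {w, u, v} \<in> N \<and> {w, x, y} \<in> N \<and>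
      {w, x, v} \<in> N \<and> {w, u, y} \<in> M - N"
      using b no by (simp add: insert_commute)
    then show False using none by blast
  qed
  obtain B x y where B: "B \<in> N" "x \<in> B" "y \<notin> B" "insert y (B - {x}) \<in> M - N"
    using boundary_basis[OF M sub _ ne] N unfolding matroid_bases_def by metis
  have "card (B - {x}) = 2" using card3 B(1,2) sub by auto
  then obtain u1 u2 where u12: "B - {x} = {u1, u2}" "u1 \<noteq> u2" by (auto simp: card_2_iff)
  define V where "V = {v. v \<notin> B \<and> insert v (B - {x}) \<in> N}"
  have yV: "y \<notin> V" using B by (auto simp: V_def)
  obtain u v where uv: "u \<in> B" "v \<notin> B" "u \<in> insert x V \<longleftrightarrow> v \<notin> insert x V" "insert v (B - {u}) \<in> N"
    using crossing_exchange[OF N B(1) conn, of x "insert x V" y] yV B(2,3) by blast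
  have ux: "u \<noteq> x" and vV: "v \<in> V" using uv B(2) by (auto simp: V_def)
  have "u \<in> {u1, u2}" using u12(1) ux uv(1) by blast
  then obtain w where uw: "B - {x} = {u, w}" "u \<noteq> w"
    using u12 by (cases "u = u1") (auto simp: insert_commute)
  then have w: "B = {x, u, w}" "distinct [x, u, w]" using B(2) by auto
  have BV: "B - {x} = {u, w}" "B - {u} = {x, w}" "B - {w} = {x, u}" using w by auto
  have base: "{x, u, w} \<in> N" "{v, u, w} \<in> N" "{x, v, w} \<in> N" "{y, u, w} \<in> M" "{y, u, w} \<notin> N"
    using B uv vV w BV by (auto simp: V_def insert_commute)
  have xyw: "{x, y, w} \<notin> N" using no3[of x u w v y] base by blast
  define V2 where "V2 = {v. v \<notin> B \<and> {x, v, w} \<in> N}"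
  have "y \<notin> {x, u} \<union> V \<union> V2" using yV xyw B(3) w by (auto simp: V2_def)
  \<comment> \<open>The set consists of \<open>x\<close>, \<open>u\<close> and all their neighbours;
    an edge leaving it must end at the third element \<open>w\<close>.\<close>
  then obtain u' v' where u'v': "u' \<in> B" "v' \<notin> B" "u' \<in> {x, u} \<union> V \<union> V2 \<longleftrightarrow> v' \<notin> {x, u} \<union> V \<union> V2"
    "insert v' (B - {u'}) \<in> N"
    using crossing_exchange[OF N B(1) conn, of x "{x, u} \<union> V \<union> V2" y] by blast
  have "v' \<in> V" if "u' = x" using u'v'(2,4) that by (simp add: V_def)
  moreover have "v' \<in> V2" if "u' = u"
    using u'v'(2,4) that BV(2) by (simp add: V2_def insert_commute)
  ultimately have u'w: "u' = w" using u'v'(1,3) w(1) by blast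
  have "w \<notin> {x, u} \<union> V \<union> V2" using w by (auto simp: V_def V2_def)
  then have v': "v' \<in> V \<union> V2" using u'v'(1-3) u'w w(1) by blast
  have xuv': "{x, u, v'} \<in> N" using u'v'(4) u'w BV(3) by (simp add: insert_commute)
  \<comment> \<open>Some edge ends at \<open>y\<close>, and only \<open>w\<close> is left as its
    other end.\<close>
  obtain t where t: "t \<in> B" "insert y (B - {t}) \<in> N"
    using crossing_exchange[OF N B(1) conn, of y "{y}" x] B(2,3) by auto
  have "t \<noteq> x"
  proof
    assume "t = x"
    then show False using t(2) BV(1) base(5) by simp
  qed
  moreover have "t \<noteq> u"
  proof
    assume "t = u"
    then show False using t(2) BV(2) xyw by (simp add: insert_commute)
  qed
  ultimately have "insert y (B - {w}) \<in> N" using t w(1) by blast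
  then have xuy: "{x, u, y} \<in> N" using BV(3) by (simp add: insert_commute)
  \<comment> \<open>A common neighbour \<open>z\<close> of \<open>x\<close> and \<open>w\<close>
    would give the three-edge path x - z - w - y.\<close>
  have no_w: "{z, u, w} \<notin> N" if z: "{x, u, z} \<in> N" for z
  proof
    assume "{z, u, w} \<in> N"
    then have "{z, w, u} \<in> N" "{x, z, u} \<in> N" "{x, w, u} \<in> N" "{x, y, u} \<in> N" "{y, w, u} \<in> M"
      using z xuy base(1,4) by (simp_all add: insert_commute)
    then have "{y, w, u} \<in> N" using no3 by blast
    then show False using base(5) by (simp add: insert_commute)
  qed
  then have v'2: "{v', u, w} \<notin> N" "{x, v', w} \<in> N"
    using v' xuv' BV(1) by (auto simp: V_def V2_def)
  have xuv: "{x, u, v} \<notin> N" using no_w base by blast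
  show False
  \<comment> \<open>The path is now x - v - u - v' - w - y. If \<open>y\<close> can replace
    \<open>u\<close> in \<open>M\<close>, then u - v' - w - y has three edges and \<open>u\<close>
    takes the role of \<open>x\<close>. Otherwise pass to the basis \<open>{x, w, v}\<close>, where
    x - v' - w - y is a path of three edges.\<close>
  proof (cases "{x, y, w} \<in> M")
    case True
    have "{u, w, x} \<in> N" "{v', w, x} \<in> N" "{u, v', x} \<in> N" "{u, y, x} \<in> N" "{y, w, x} \<in> M"
      using base(1) v'2(2) xuv' xuy True by (simp_all add: insert_commute)
    then have "{y, w, x} \<in> N" using no3 by blast
    then show False using xyw by (simp add: insert_commute)
  next
    case False
    have d: "distinct [x, v', w]" "distinct [x, v, w]" "distinct [v, u, w]" "distinct [x, u, v']"
       "distinct [x, u, y]" "distinct [y, u, w]"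
      using dist base v'2 xuv' xuy sub by blast+
    have 1: "{v', w, v} \<in> N"
    proof -
      obtain z where "z \<in> {v, u, w}" "{z, v', w} \<in> N"
        using exchange_triple[OF N v'2(2) base(2)] d by auto
      then show ?thesis using v'2 d dist[of w v' w] sub by (auto simp: insert_commute)
    qed
    have 2: "{x, v', v} \<in> N"
    proof -
      have "{w, x, v} \<in> N" "w \<notin> {x, u, v'}" using base(3) d w by (auto simp: insert_commute)
      then obtain z where "z \<in> {x, u, v'}" "{z, x, v} \<in> N"
        using exchange_triple[OF N _ xuv', of w x v] d by auto
      then show ?thesis using xuv d dist[of x x v] sub by (auto simp: insert_commute)
    qed
    have 3: "{x, y, v} \<in> N"
    proof -
      have "{w, x, v} \<in> N" "w \<notin> {x, u, y}" using base(3) d w by (auto simp: insert_commute)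
      then obtain z where "z \<in> {x, u, y}" "{z, x, v} \<in> N"
        using exchange_triple[OF N _ xuy, of w x v] d by auto
      then show ?thesis using xuv d dist[of x x v] sub by (auto simp: insert_commute)
    qed
    have 4: "{y, w, v} \<notin> N"
    proof
      assume "{y, w, v} \<in> N"
      then have a: "{v, y, w} \<in> N" by (simp add: insert_commute)
      have "v \<notin> {x, u, w}" using d by auto
      then obtain z where "z \<in> {x, u, w}" "{z, y, w} \<in> N"
        using exchange_triple[OF N a base(1)] dist[of v y w] a sub by blast
      then show False using base xyw dist[of w y w] sub by (auto simp: insert_commute)
    qed
    have 5: "{y, w, v} \<in> M"
    proof -
      have a: "{u, y, w} \<in> M" "{x, v, w} \<in> M" using base sub by (auto simp: insert_commute)
      have "u \<notin> {x, v, w}" using d w by auto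
      then obtain z where "z \<in> {x, v, w}" "{z, y, w} \<in> M"
        using exchange_triple[OF M a] dist[of u y w] a by blast
      then show ?thesis using False dist[of w y w] by (auto simp: insert_commute)
    qed
    have "{x, w, v} \<in> N" using base(3) by (simp add: insert_commute)
    then show False using no3[OF _ 1 2 3 5] 4 by blast
  qed
qed

section \<open>The nine-point matroid\<close>

definition ground_list :: "ground list" where
  "ground_list = [Ea, Eb, Ec, Ed, Ee, Ef, Eg, Eh, Ei]"

definition line_list :: "ground list list" where
  "line_list = [[Eb, Ed, Ef, Eh], [Ea, Eb, Ec], [Ea, Ed, Ee], [Ea, Ef, Eg], [Ea, Eh, Ei],
     [Eb, Eg, Ei], [Ec, Ed, Ei], [Ec, Ee, Ef], [Ee, Eg, Eh]]"

definition collinear_list :: "ground list \<Rightarrow> bool" where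
  "collinear_list xs \<longleftrightarrow> (\<exists>l\<in>set line_list. \<forall>x\<in>set xs. x \<in> set l)"

definition octahedron_list :: "ground \<Rightarrow> ground list \<Rightarrow> bool" where
  "octahedron_list p Q \<longleftrightarrow> p \<notin> set Q \<and>
     (\<forall>q\<in>set Q. \<forall>r\<in>set Q. q = r \<or> \<not> collinear_list [p, q, r])"

text \<open>Outer points appear in the order of \<open>ground_list\<close>, so each four-element set
  has one list and equality of sets can be tested on lists.\<close>

definition octahedra :: "(ground \<times> ground list) list" where
  "octahedra = [(p, Q). p \<leftarrow> ground_list, Q \<leftarrow> subseqs ground_list, length Q = 4 \<and> octahedron_list p Q]"

text \<open>Two octahedra are linked if \<open>whole_parallel\<close> or \<open>whole_swap\<close> leads from one to the other.\<close>

fun linked :: "ground \<times> ground list \<Rightarrow> ground \<times> ground list \<Rightarrow> bool" where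
  "linked (p, Q) (p', Q') \<longleftrightarrow>
     (if p = p' then
        (case filter (\<lambda>x. x \<notin> set Q') Q of [t] \<Rightarrow>
          (case filter (\<lambda>x. x \<notin> set Q) Q' of [t'] \<Rightarrow> collinear_list [p, t, t'] | _ \<Rightarrow> False)
         | _ \<Rightarrow> False)
      else p \<in> set Q' \<and> p' \<in> set Q \<and>
        (let S = removeAll p' Q in S = removeAll p Q' \<and> collinear_list S))"

text \<open>Breadth-first search: \<open>R\<close> holds the octahedra not yet reached,
  \<open>F\<close> the latest layer, and \<open>k\<close> bounds the number of layers.\<close>

fun exhausts :: "nat \<Rightarrow> (ground \<times> ground list) list \<Rightarrow> (ground \<times> ground list) list \<Rightarrow> bool" where
  "exhausts 0 R F \<longleftrightarrow> R = []"
| "exhausts (Suc k) R F \<longleftrightarrow>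
     (let new = filter (\<lambda>m. \<exists>n\<in>set F. linked n m) R;
          rest = filter (\<lambda>m. \<not> (\<exists>n\<in>set F. linked n m)) R
      in exhausts k rest new)"

lemma exhausts_octahedra: "exhausts 12 octahedra [(Ea, [Eb, Ed, Ef, Eh])]"
  by code_simp

lemma set_ground_list: "set ground_list = UNIV"
  by (simp add: ground_list_def UNIV_ground)

lemma distinct_ground_list: "distinct ground_list"
  by (simp add: ground_list_def)

lemma ground_triple_in_M_bases:
  "{x, y, z} \<in> M_bases \<longleftrightarrow> distinct [x, y, z] \<and> \<not> collinear_list [x, y, z]"
proof -
  have "(\<exists>F\<in>M_lines. {x, y, z} \<subseteq> F) \<longleftrightarrow> collinear_list [x, y, z]"
    unfolding M_lines_def collinear_list_def line_list_def by simp
  moreover have "card {x, y, z} = 3 \<longleftrightarrow> distinct [x, y, z]"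
    by (auto simp: card_insert_if)
  ultimately show ?thesis unfolding M_bases_iff by blast
qed

section \<open>Moving splits between the octahedra of M\<close>

locale M_subdivision = rank3_subdivision M_bases \<C> for \<C> :: "ground set set set"
begin

lemma octahedron_iff_list:
  assumes "distinct [q, r, s, t]"
  shows "octahedron p q r s t \<longleftrightarrow> octahedron_list p [q, r, s, t]"
  using assms unfolding octahedron_def octahedron_list_def ground_triple_in_M_bases
  by (auto simp: collinear_list_def)

lemma whole_linked:
  assumes l: "linked (p, Q) (p', Q')"
    and Q: "octahedron_list p Q" "distinct Q" "length Q = 4"
    and Q': "octahedron_list p' Q'" "distinct Q'" "length Q' = 4"
    and w: "whole p (set Q)"
  shows "whole p' (set Q')"
proof (cases "p = p'")
  case True
  then obtain t t' where t: "filter (\<lambda>x. x \<notin> set Q') Q = [t]" "filter (\<lambda>x. x \<notin> set Q) Q' = [t']"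
      "collinear_list [p, t, t']"
    using l by (auto split: list.splits)
  have tt: "set Q - set Q' = {t}" "set Q' - set Q = {t'}"
    using arg_cong[OF t(1), of set] arg_cong[OF t(2), of set] by auto
  have "card (set Q \<inter> set Q') = 3"
    using card_Diff_subset_Int[of "set Q" "set Q'"] tt Q(2,3) distinct_card[OF Q(2)] by simp
  then obtain q r s where S: "set Q \<inter> set Q' = {q, r, s}" "distinct [q, r, s]"
    by (auto simp: card_3_iff)
  have sets: "set Q = {q, r, s, t}" "set Q' = {q, r, s, t'}" using S(1) tt by auto
  have d: "distinct [q, r, s, t]" "distinct [q, r, s, t']" using S tt by auto
  have "octahedron p q r s t" "octahedron p q r s t'"
    using Q(1) Q'(1) True d unfolding octahedron_iff_list[OF d(1)] octahedron_iff_list[OF d(2)]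
    by (simp_all add: octahedron_list_def sets)
  moreover have "{p, t, t'} \<notin> M_bases"
    using t(3) by (simp add: ground_triple_in_M_bases)
  ultimately show ?thesis using whole_parallel[of p q r s t t'] w True sets by simp
next
  case False
  then have S: "p \<in> set Q'" "p' \<in> set Q" "removeAll p' Q = removeAll p Q'" "collinear_list (removeAll p' Q)"
    using l by (auto simp: Let_def)
  have "card (set Q - {p'}) = 3"
    using S(2) Q distinct_card[OF Q(2)] by simp
  then obtain q r s where qrs: "set Q - {p'} = {q, r, s}" "distinct [q, r, s]"
    by (auto simp: card_3_iff)
  have "set Q' - {p} = {q, r, s}" using qrs(1) arg_cong[OF S(3), of set] by simp
  then have sets: "set Q = {q, r, s, p'}" "set Q' = {q, r, s, p}"
    using S(1,2) qrs by auto
  have d: "distinct [q, r, s, p']" "distinct [q, r, s, p]"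
    using qrs \<open>set Q' - {p} = {q, r, s}\<close> by auto
  have "octahedron p q r s p'" "octahedron p' q r s p"
    using Q(1) Q'(1) d unfolding octahedron_iff_list[OF d(1)] octahedron_iff_list[OF d(2)]
    by (simp_all add: octahedron_list_def sets)
  moreover have "set (removeAll p' Q) = set [q, r, s]" using qrs(1) by simp
  then have "collinear_list [q, r, s]" using S(4) unfolding collinear_list_def by (simp only:)
  then have "{q, r, s} \<notin> M_bases" by (simp add: ground_triple_in_M_bases)
  ultimately show ?thesis using whole_swap[of p q r s p'] w sets by simp
qed

lemma whole_if_exhausts:
  assumes "exhausts k R F" "set R \<subseteq> set octahedra" "set F \<subseteq> set octahedra"
    and "\<forall>(p, Q)\<in>set F. whole p (set Q)"
  shows "\<forall>(p, Q)\<in>set R. whole p (set Q)"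
  using assms
proof (induction k arbitrary: R F)
  case (Suc k)
  have ok: "octahedron_list p Q \<and> distinct Q \<and> length Q = 4" if "(p, Q) \<in> set octahedra" for p Q
    using that subseqs_distinctD[of Q ground_list] distinct_ground_list unfolding octahedra_def by auto
  let ?new = "filter (\<lambda>m. \<exists>n\<in>set F. linked n m) R"
  let ?rest = "filter (\<lambda>m. \<not> (\<exists>n\<in>set F. linked n m)) R"
  have new: "whole p' (set Q')" if m: "(p', Q') \<in> set ?new" for p' Q'
  proof -
    obtain p Q where n: "(p, Q) \<in> set F" "linked (p, Q) (p', Q')" using m by auto
    have "octahedron_list p Q \<and> distinct Q \<and> length Q = 4"
      "octahedron_list p' Q' \<and> distinct Q' \<and> length Q' = 4"
      using ok n(1) m Suc.prems(2,3) by auto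
    then show ?thesis using whole_linked[OF n(2)] n(1) Suc.prems(4) by blast
  qed
  have "\<forall>(p, Q)\<in>set ?rest. whole p (set Q)"
  proof (rule Suc.IH)
    show "exhausts k ?rest ?new" using Suc.prems(1) by (simp add: Let_def)
  qed (use Suc.prems(2) new in auto)
  then show ?case using new by fastforce
qed simp

lemma octahedra_complete:
  assumes "octahedron p q r s t"
  obtains Q where "(p, Q) \<in> set octahedra" "set Q = {q, r, s, t}"
proof -
  note g = set_ground_list distinct_ground_list
  note d = octahedron_distinct[OF assms]
  have "{q, r, s, t} \<in> set ` set (subseqs ground_list)"
    by (simp add: subseqs_powset g)
  then obtain Q where Q: "Q \<in> set (subseqs ground_list)" "set Q = {q, r, s, t}" by auto
  have "distinct Q" using subseqs_distinctD[OF Q(1) g(2)] .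
  then have "length Q = card {q, r, s, t}" using distinct_card Q(2) by metis
  then have "length Q = 4" using d by simp
  moreover have "octahedron_list p Q"
    using assms d octahedron_iff_list[of q r s t p] by (simp add: octahedron_list_def Q(2))
  ultimately have "(p, Q) \<in> set octahedra"
    using Q(1) g(1) unfolding octahedra_def by auto
  then show ?thesis using that Q(2) by blast
qed

lemmas decide = octahedron_def ground_triple_in_M_bases collinear_list_def line_list_def

text \<open>The lines through c group the other points as ab, di, ef, g, h. The five octahedra at c
  use the four-element subsets of the representatives a, d, f, g, h, with arguments ordered so that
  corresponding entries of the profiles agree.\<close>

lemma profile_eqs:
  defines "\<pi> \<equiv> profile Ea Eb Ed Ef Eh"
  shows "profile Ec Ea Ed Ef Eh = \<pi>" "profile Ec Ea Ef Eg Eh = \<pi>" "profile Ec Ed Ea Eg Eh = \<pi>"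
    "profile Ec Ed Eg Ea Ef = \<pi>" "profile Ec Ed Eg Ef Eh = \<pi>"
proof -
  have "profile Ec Ea Ed Ef Eh = profile Ea Ec Ed Ef Eh"
    by (rule profile_swap) (simp_all add: decide)
  also have "\<dots> = \<pi>" unfolding \<pi>_def
    by (rule profile_parallel) (simp_all add: decide)
  finally show "profile Ec Ea Ed Ef Eh = \<pi>" .
  have "profile Ec Ea Ef Eg Eh = profile Ec Ea Ee Eg Eh"
    by (rule profile_parallel) (simp_all add: decide)
  also have "\<dots> = profile Ea Ec Ee Eg Eh"
    by (rule profile_swap) (simp_all add: decide)
  also have "\<dots> = profile Ea Eb Ee Eg Eh"
    by (rule profile_parallel) (simp_all add: decide)
  also have "\<dots> = profile Ea Eb Ed Eg Eh"
    by (rule profile_parallel) (simp_all add: decide)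
  also have "\<dots> = \<pi>" unfolding \<pi>_def
    by (rule profile_parallel) (simp_all add: decide)
  finally show c: "profile Ec Ea Ef Eg Eh = \<pi>" .
  have "profile Ec Ed Ea Eg Eh = profile Ec Ei Ea Eg Eh"
    by (rule profile_parallel) (simp_all add: decide)
  also have "\<dots> = profile Ec Ei Eb Eg Eh"
    by (rule profile_parallel) (simp_all add: decide)
  also have "\<dots> = profile Eh Ei Eb Eg Ec"
    by (rule profile_swap) (simp_all add: decide)
  also have "\<dots> = profile Eh Ea Eb Eg Ec"
    by (rule profile_parallel) (simp_all add: decide)
  also have "\<dots> = profile Eh Ea Ef Eg Ec"
    by (rule profile_parallel) (simp_all add: decide)
  also have "\<dots> = profile Ec Ea Ef Eg Eh"
    by (rule profile_swap) (simp_all add: decide)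
  also note c
  finally show "profile Ec Ed Ea Eg Eh = \<pi>" .
  have "profile Ed Ec Eg Ea Eb = profile Eg Ec Ed Ea Eb"
    by (rule profile_swap) (simp_all add: decide)
  also have "\<dots> = profile Eg Ec Ed Ea Ei"
    by (rule profile_parallel) (simp_all add: decide)
  also have "\<dots> = profile Ea Ec Ed Eg Ei"
    by (rule profile_swap) (simp_all add: decide)
  also have "\<dots> = profile Ea Eb Ed Eg Ei"
    by (rule profile_parallel) (simp_all add: decide)
  also have "\<dots> = profile Ea Eb Ed Ef Ei"
    by (rule profile_parallel) (simp_all add: decide)
  also have "\<dots> = \<pi>" unfolding \<pi>_def
    by (rule profile_parallel) (simp_all add: decide)
  finally have d: "profile Ed Ec Eg Ea Eb = \<pi>" .
  have "profile Ec Ed Eg Ea Ef = profile Ed Ec Eg Ea Ef"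
    by (rule profile_swap) (simp_all add: decide)
  also have "\<dots> = profile Ed Ec Eg Ea Eb"
    by (rule profile_parallel) (simp_all add: decide)
  also note d
  finally show "profile Ec Ed Eg Ea Ef = \<pi>" .
  have "profile Ec Ed Eg Ef Eh = profile Ec Ed Eg Ee Eh"
    by (rule profile_parallel) (simp_all add: decide)
  also have "\<dots> = profile Ed Ec Eg Ee Eh"
    by (rule profile_swap) (simp_all add: decide)
  also have "\<dots> = profile Ed Ec Eg Ea Eh"
    by (rule profile_parallel) (simp_all add: decide)
  also have "\<dots> = profile Ed Ec Eg Ea Eb"
    by (rule profile_parallel) (simp_all add: decide)
  also note d
  finally show "profile Ec Ed Eg Ef Eh = \<pi>" .
qed

lemma profile_trivial: "profile Ea Eb Ed Ef Eh = (False, False, False)"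
proof -
  let ?S = "split Ea Eb Ed Ef Eh" and ?S' = "split Ea Eb Ef Ed Eh" and ?S'' = "split Ea Eb Eh Ed Ef"
  have x: "split Ec Ea Ed Ef Eh" "split Ec Ea Ef Eg Eh" "split Ec Ed Eg Ea Ef" if ?S
    using that profile_eqs unfolding profile_def by auto
  \<comment> \<open>At c, af|gh and af|dg give af|dh, but ad|fh is also a split of that
    octahedron.\<close>
  have "\<not> ?S"
  proof
    assume ?S
    note x = x[OF this]
    have "split Ec Ea Ef Eh Ed"
      by (rule split_trans[where t = Eg and x = Ea])
        (use x in \<open>simp_all add: decide split_commute\<close>)
    moreover have "\<not> split Ec Ea Ef Ed Eh"
      by (rule split_unique) (use x in \<open>simp_all add: decide\<close>)
    ultimately show False by (simp add: split_commute)
  qed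
  \<comment> \<open>Here the five splits at c form the pentagon with cyclic order h, g, d, a,
    f.\<close>
  moreover have "\<not> ?S'"
  proof
    assume ?S'
    then have "split Ec Ea Ef Ed Eh" "split Ec Ea Eg Ef Eh" "split Ec Ed Ea Eg Ef"
      "split Ec Ed Eg Ea Eh" "split Ec Ed Ef Eg Eh"
      using profile_eqs unfolding profile_def by auto
    then show False
      by (intro no_pentagon_of_splits[of Ec Eg Ed Ea Ef Eh]) (simp_all add: decide split_commute)
  qed
  \<comment> \<open>At c, ah|df and ah|fg give ah|dg, which conflicts with dh|ag.\<close>
  moreover have "\<not> ?S''"
  proof
    assume ?S''
    then have z: "split Ec Ea Eh Ed Ef" "split Ec Ea Eh Ef Eg" "split Ec Ed Eh Ea Eg"
      using profile_eqs unfolding profile_def by auto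
    have "split Ec Ea Eh Ed Eg"
      by (rule split_trans[where t = Ef and x = Ea])
        (use z in \<open>simp_all add: decide split_commute\<close>)
    moreover have "\<not> split Ec Ea Eh Ed Eg"
      using split_unique[of Ec Eh Ed Ea Eg] z by (simp add: decide split_commute)
    ultimately show False by simp
  qed
  ultimately show ?thesis by (simp add: profile_def)
qed

text \<open>The starting octahedron has no split, hence is whole, and the search carries wholeness
  along links to every octahedron.\<close>

lemma no_split:
  assumes "octahedron p q r s t"
  shows "\<not> split p q r s t"
proof
  assume sp: "split p q r s t"
  have o: "octahedron Ea Eb Ed Ef Eh" by (simp add: decide)
  then have "whole Ea (set [Eb, Ed, Ef, Eh])"
    using whole_iff_profile profile_trivial by simp
  moreover have "(Ea, [Eb, Ed, Ef, Eh]) \<in> set octahedra"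
    by code_simp
  ultimately have "\<forall>(p, Q)\<in>set octahedra. whole p (set Q)"
    by (intro whole_if_exhausts[OF exhausts_octahedra]) auto
  moreover obtain Q where "(p, Q) \<in> set octahedra" "set Q = {q, r, s, t}"
    by (rule octahedra_complete[OF assms])
  ultimately have "whole p {q, r, s, t}" by auto
  then show False using sp whole_iff_profile[OF assms] by (simp add: profile_def)
qed

end

section \<open>Connectedness of M and the conclusion\<close>

lemma M_four_point_circuit:
  assumes "x \<noteq> y"
  shows "\<exists>z w. distinct [x, y, z, w] \<and> {x, y, z} \<in> M_bases \<and> {x, y, w} \<in> M_bases \<and>
    {x, z, w} \<in> M_bases \<and> {y, z, w} \<in> M_bases"
proof -
  have "\<forall>x\<in>set ground_list. \<forall>y\<in>set ground_list. x = y \<or> (\<exists>z\<in>set ground_list. \<exists>w\<in>set ground_list.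
     distinct [x, y, z, w] \<and> \<not> collinear_list [x, y, z] \<and> \<not> collinear_list [x, y, w] \<and>
     \<not> collinear_list [x, z, w] \<and> \<not> collinear_list [y, z, w])"
    by code_simp
  then obtain z w where "distinct [x, y, z, w]" "\<not> collinear_list [x, y, z]"
    "\<not> collinear_list [x, y, w]" "\<not> collinear_list [x, z, w]" "\<not> collinear_list [y, z, w]"
    using assms unfolding set_ground_list by blast
  then show ?thesis unfolding ground_triple_in_M_bases by (intro exI[of _ z] exI[of _ w]) auto
qed

text \<open>Any two points extend to four points with no three on a common line, and these form a
  circuit.\<close>

lemma M_connected: "(x, y) \<in> connected_rel M_bases"
proof (cases "x = y")
  case False
  obtain z w where zw: "distinct [x, y, z, w]" "{x, y, z} \<in> M_bases" "{x, y, w} \<in> M_bases"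
    "{x, z, w} \<in> M_bases" "{y, z, w} \<in> M_bases"
    using M_four_point_circuit[OF False] by blast
  let ?C = "{x, y, z, w}"
  have "circuit M_bases ?C"
    unfolding circuit_def
  proof (intro conjI allI impI)
    show "\<not> indep M_bases ?C"
    proof
      assume "indep M_bases ?C"
      then obtain B where "card B = 3" "?C \<subseteq> B" unfolding indep_def using M_bases_iff by blast
      then have "card ?C \<le> 3" by (metis card_mono finite)
      then show False using zw(1) by simp
    qed
    fix D assume "D \<subset> ?C"
    then obtain e where "e \<in> ?C" "D \<subseteq> ?C - {e}" by blast
    moreover have "?C - {x} = {y, z, w}" "?C - {y} = {x, z, w}" "?C - {z} = {x, y, w}"
      "?C - {w} = {x, y, z}" using zw(1) by auto
    ultimately have "\<exists>B\<in>M_bases. D \<subseteq> B" using zw(2-) by (metis insertE singletonD)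
    then show "indep M_bases D" unfolding indep_def .
  qed
  then show ?thesis unfolding connected_rel_def by blast
qed (simp add: connected_rel_def)

lemma connected_components_eq_M_D:
  assumes "connected_components N = connected_components M_bases"
  shows "(x, y) \<in> connected_rel N"
proof -
  have "connected_components M_bases = {UNIV}"
    unfolding connected_components_def quotient_def using M_connected by auto
  moreover have "connected_rel N `` {x} \<in> connected_components N"
    unfolding connected_components_def by (rule quotientI) simp
  ultimately show ?thesis using assms by auto
qed

theorem theorem5p7: "\<not> decomposable M_bases"
proof
  assume "decomposable M_bases"
  then obtain k :: nat and N :: "nat \<Rightarrow> ground set set" where k: "2 \<le> k"
    and all: "\<forall>i<k. matroid_bases (N i)"
      "\<forall>i<k. connected_components (N i) = connected_components M_bases"
    and un: "(\<Union>i<k. base_polytope (N i)) = base_polytope M_bases"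
    and faces: "\<forall>i<k. \<forall>j<k. i \<noteq> j \<longrightarrow>
      proper_face (base_polytope (N i) \<inter> base_polytope (N j)) (base_polytope (N i)) \<and>
      proper_face (base_polytope (N i) \<inter> base_polytope (N j)) (base_polytope (N j))"
    unfolding decomposable_def by blast
  have mat: "matroid_bases (N i)" and comp: "connected_components (N i) = connected_components M_bases"
    if "i < k" for i using all that by blast+
  have face: "proper_face (base_polytope (N i) \<inter> base_polytope (N j)) (base_polytope (N i))"
    if "i < k" "j < k" "i \<noteq> j" for i j using faces that by blast
  let ?C = "N ` {..<k}"
  interpret M_subdivision ?C
  proof
    fix X Y assume "X \<in> ?C" "Y \<in> ?C"
    then obtain i j where ij: "i < k" "j < k" "X = N i" "Y = N j" by auto
    show "base_polytope X \<inter> base_polytope Y face_of base_polytope X"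
    proof (cases "i = j")
      case True
      then show ?thesis using ij face_of_refl[OF convex_base_polytope] by simp
    next
      case False
      then show ?thesis using face ij unfolding proper_face_def by blast
    qed
  qed (use mat un in \<open>auto simp: M_bases_iff\<close>)
  \<comment> \<open>Two cells equal to M would meet in their whole polytope, which is not a proper
    face.\<close>
  have "N 0 \<noteq> M_bases \<or> N 1 \<noteq> M_bases"
    using face[of 0 1] k unfolding proper_face_def by auto
  then obtain i where i: "i < k" "N i \<noteq> M_bases" using k by force
  have sub: "N i \<subseteq> M_bases" using i(1) by (intro cell_subset) auto
  obtain w x u v y where c: "{w, x, u} \<in> N i" "{w, v, y} \<in> N i" "{w, u, v} \<in> N i" "{w, x, y} \<in> N i"
    "{w, x, v} \<in> N i" "{w, u, y} \<in> M_bases - N i"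
    using weak_image_half_octahedron[OF matroid_bases_M mat[OF i(1)] sub i(2) _
        connected_components_eq_M_D[OF comp[OF i(1)]]] card_base by blast
  have o: "octahedron w x v u y"
    using c sub unfolding octahedron_def by (auto simp: insert_commute)
  note d = octahedron_distinct[OF o]
  \<comment> \<open>The cell contains both ends of the diagonal from \<open>{w, x, u}\<close> to
    \<open>{w, v, y}\<close>, hence the centre. As it lacks \<open>{w, u, y}\<close>, the diagonal
    ending there is split.\<close>
  have "octahedron_center w x v u y \<in> base_polytope (N i)"
    using octahedron_center_eq_midpoint(2)[OF d] c(1,2)
    by (metis base_polytope_def incidence_vector_in_base_polytope_iff midpoints_in_convex_hull)
  then have "split w x v u y"
    using diagonal_in_cell(2)[of w x v u y "N i"] i(1) d c(6) by blast
  then show False using no_split[OF o] by blast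
qed

end
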